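(* Let $\rho\ge 1$ and $0<\theta<\pi/2$ satisfy $0<\rho\cos\theta<1/2$, let $\Lambda\subset\mathbb{R}^2$ be the lattice generated by $(1,0)$ and $(\rho\cos\theta,\rho\sin\theta)$, and let $X=(X_1,X_2)$ be uniformly distributed on the Babai cell $\mathcal{B}(0)=(-1/2,1/2]\times(-\tfrac{\rho}{2}\sin\theta,\tfrac{\rho}{2}\sin\theta]$, where $X_1$ is known only to node $S_1$ and $X_2$ only to node $S_2$. Then, in the interactive model with unlimited rounds of communication, the nearest plane partition can be transformed into the Voronoi partition using, on average, a finite number of bits and rounds of communication. Specifically, for the interactive protocol described in the context: the protocol halts with probability one; when it halts, both nodes know the point of $\Lambda$ closest to $X$ (zero error probability); and the number $R(X)$ of communicated bits and the number $N(X)$ of rounds used satisfy $$\bar R:=E[R(X)]=H(Q)+(1-Q_0)H(P)+4(1-P_0)(1-Q_0),$$ $$\bar N:=E[N(X)]=1+2(1-P_0)(1-Q_0),$$ where $Q=(Q_{-1},Q_0,Q_1)$ with $Q_i=\Pr(U_2=i)$, and $P=(P_{-1},P_0,P_1)$ with $P_i=\Pr(U_1=i\mid U_2=1)$, for the Round-1 messages $U_2,U_1$ defined in the context.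
   Context: For a probability vector $p$, $H(p)=-\sum_i p_i\log_2 p_i$ (with $0\log_2 0=0$). The Voronoi cell $\mathcal{V}(\lambda)$, $\lambda\in\Lambda$, is the set of all $x\in\mathbb{R}^2$ for which $\lambda$ is a closest lattice point in Euclidean distance. The Babai (nearest plane) partition is the partition of the plane into the translates $\lambda+\mathcal{B}(0)$, $\lambda\in\Lambda$; after the nearest plane point has been found and subtracted, the remaining vector $X$ is modelled as uniform on $\mathcal{B}(0)$. All statements below ignore events of probability zero. Notation: $H=\rho\sin\theta$, $H_1=\dfrac{\cos\theta\,(1-\rho\cos\theta)}{2\sin\theta}$, $\tau_1=H/2-H_1$, $\tau_{-1}=-\tau_1$, $t_{-2}=(\rho\cos\theta-1)/2$, $t_1=(\rho\cos\theta)/2$. Intervals for $X_2$: $J_{-1}=(-H/2,\tau_{-1}]$, $J_0=(\tau_{-1},\tau_1]$, $J_1=(\tau_1,H/2]$. Intervals for $X_1$: $I_{-1}=(-1/2,t_{-2}]$, $I_0=(t_{-2},t_1]$, $I_1=(t_1,1/2]$. A rectangle contained in $\mathcal{B}(0)$ is called error-free if its interior contains no point of the boundary of $\mathcal{V}(0)$. Protocol. Round 1: $S_2$ sends $U_2\in\{-1,0,1\}$, the index $i$ with $X_2\in J_i$, at a cost of $\log_2(1/Q_i)$ bits (ideal entropy code). If $U_2=1$, then $S_1$ sends the index $U_1=j$ with $X_1\in I_j$; if $U_2=-1$, then $S_1$ sends the index $U_1=j$ with $X_1\in -I_j$; in both cases the cost is $\log_2(1/P_j)$ bits. If $U_2=0$,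 $S_1$ sends nothing (cost $0$). After Round 1 both nodes know which of the resulting seven rectangles contains $X$: $(-1/2,1/2]\times J_0$, the three rectangles $I_j\times J_1$, and the three rectangles $(-I_j)\times J_{-1}$. If that rectangle is error-free, the protocol halts after this one round. Each later round: the current rectangle (not error-free) is divided into four congruent rectangles by halving both of its sides; $S_2$ sends one bit telling in which half of the vertical side $X_2$ lies, and $S_1$ sends one bit telling in which half of the horizontal side $X_1$ lies (2 bits in total). The sub-rectangle containing $X$ becomes the current rectangle; if it is error-free the protocol halts, otherwise another such round follows. $N(X)$ is the total number of rounds, including Round 1, and $R(X)$ the total number of bits (costs) when the protocol halts. *)

theory Defs
  imports "HOL-Probability.Probability"
begin

definition lat :: "real \<Rightarrow> real \<Rightarrow> (real \<times> real) set" where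
  "lat \<rho> \<theta> = {of_int m *\<^sub>R (1, 0) + of_int n *\<^sub>R (\<rho> * cos \<theta>, \<rho> * sin \<theta>) | m n :: int. True}"

definition voronoi_cell :: "real \<Rightarrow> real \<Rightarrow> real \<times> real \<Rightarrow> (real \<times> real) set" where
  "voronoi_cell \<rho> \<theta> p = {x. \<forall>q\<in>lat \<rho> \<theta>. dist x p \<le> dist x q}"

definition babai_cell :: "real \<Rightarrow> real \<Rightarrow> (real \<times> real) set" where
  "babai_cell \<rho> \<theta> = {-1/2<..1/2} \<times> {-(\<rho> / 2 * sin \<theta>)<..\<rho> / 2 * sin \<theta>}"

text \<open>The law of \<open>X\<close>; on this probability space \<open>X\<close> is the identity.\<close>

definition babai_law :: "real \<Rightarrow> real \<Rightarrow> (real \<times> real) measure" where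
  "babai_law \<rho> \<theta> = uniform_measure lborel (babai_cell \<rho> \<theta>)"

lemma prob_space_babai_law:
  assumes "0 < \<rho> * sin \<theta>"
  shows "prob_space (babai_law \<rho> \<theta>)"
proof -
  let ?h = "\<rho> / 2 * sin \<theta>"
  have "emeasure lborel (babai_cell \<rho> \<theta>)
      = emeasure lborel {-1/2<..1/2::real} * emeasure lborel {- ?h<..?h}"
    unfolding babai_cell_def lborel_prod[symmetric]
    by (rule lborel.emeasure_pair_measure_Times) auto
  also have "\<dots> = ennreal (\<rho> * sin \<theta>)"
    using assms by (simp add: ennreal_mult[symmetric])
  finally show ?thesis
    unfolding babai_law_def using assms by (intro prob_space_uniform_measure) auto
qed

definition cell_height :: "real \<Rightarrow> real \<Rightarrow> real" where
  "cell_height \<rho> \<theta> = \<rho> * sin \<theta>"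

definition H1 :: "real \<Rightarrow> real \<Rightarrow> real" where
  "H1 \<rho> \<theta> = cos \<theta> * (1 - \<rho> * cos \<theta>) / (2 * sin \<theta>)"

definition tau1 :: "real \<Rightarrow> real \<Rightarrow> real" where
  "tau1 \<rho> \<theta> = cell_height \<rho> \<theta> / 2 - H1 \<rho> \<theta>"

definition t_m2 :: "real \<Rightarrow> real \<Rightarrow> real" where
  "t_m2 \<rho> \<theta> = (\<rho> * cos \<theta> - 1) / 2"

definition t_1 :: "real \<Rightarrow> real \<Rightarrow> real" where
  "t_1 \<rho> \<theta> = (\<rho> * cos \<theta>) / 2"

text \<open>An interval is represented by its pair of endpoints, and a rectangle by its horizontal
  and its vertical side. Which endpoints belong to the interval is recorded only where a message
  is chosen in Round 1; for everything else it affects a null set only.\<close>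

type_synonym ivl = "real \<times> real"
type_synonym rect = "ivl \<times> ivl"

definition half_open :: "ivl \<Rightarrow> real set" where
  "half_open K = {fst K<..snd K}"

definition reflect :: "ivl \<Rightarrow> ivl" where
  "reflect K = (- snd K, - fst K)"

definition I_ivl :: "real \<Rightarrow> real \<Rightarrow> int \<Rightarrow> ivl" where
  "I_ivl \<rho> \<theta> j =
     (if j = -1 then (-1/2, t_m2 \<rho> \<theta>)
      else if j = 0 then (t_m2 \<rho> \<theta>, t_1 \<rho> \<theta>)
      else (t_1 \<rho> \<theta>, 1/2))"

definition J_ivl :: "real \<Rightarrow> real \<Rightarrow> int \<Rightarrow> ivl" where
  "J_ivl \<rho> \<theta> i =
     (if i = -1 then (- cell_height \<rho> \<theta> / 2, - tau1 \<rho> \<theta>)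
      else if i = 0 then (- tau1 \<rho> \<theta>, tau1 \<rho> \<theta>)
      else (tau1 \<rho> \<theta>, cell_height \<rho> \<theta> / 2))"

definition error_free :: "real \<Rightarrow> real \<Rightarrow> rect \<Rightarrow> bool" where
  "error_free \<rho> \<theta> r \<longleftrightarrow>
     interior ({fst (fst r)..snd (fst r)} \<times> {fst (snd r)..snd (snd r)})
       \<inter> frontier (voronoi_cell \<rho> \<theta> (0, 0)) = {}"

text \<open>The reflected intervals \<open>-I\<^sub>j\<close> miss the single value \<open>1/2\<close>, where the index is unspecified.\<close>

definition index_of :: "(int \<Rightarrow> real set) \<Rightarrow> real \<Rightarrow> int" where
  "index_of K x = (THE i. i \<in> {-1, 0, 1} \<and> x \<in> K i)"

definition U2 :: "real \<Rightarrow> real \<Rightarrow> real \<Rightarrow> int" where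
  "U2 \<rho> \<theta> x2 = index_of (\<lambda>i. half_open (J_ivl \<rho> \<theta> i)) x2"

text \<open>The reply of \<open>S\<^sub>1\<close>, who knows \<open>x1\<close>, to the message \<open>u2\<close> of \<open>S\<^sub>2\<close>;
  \<open>None\<close> means that nothing is sent.\<close>

definition U1 :: "real \<Rightarrow> real \<Rightarrow> real \<Rightarrow> int \<Rightarrow> int option" where
  "U1 \<rho> \<theta> x1 u2 =
     (if u2 = 1 then Some (index_of (\<lambda>j. half_open (I_ivl \<rho> \<theta> j)) x1)
      else if u2 = -1 then Some (index_of (\<lambda>j. uminus ` half_open (I_ivl \<rho> \<theta> j)) x1)
      else None)"

text \<open>All messages exchanged so far: \<open>U2\<close>, \<open>U1\<close>, and for each later round the
  bit of \<open>S\<^sub>2\<close> followed by the bit of \<open>S\<^sub>1\<close>.\<close>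

type_synonym transcript = "int \<times> int option \<times> (bool \<times> bool) list"

definition first_rect :: "real \<Rightarrow> real \<Rightarrow> int \<Rightarrow> int option \<Rightarrow> rect" where
  "first_rect \<rho> \<theta> u2 u1 =
     (case u1 of
        None \<Rightarrow> ((-1/2, 1/2), J_ivl \<rho> \<theta> 0)
      | Some j \<Rightarrow> (if u2 = 1 then (I_ivl \<rho> \<theta> j, J_ivl \<rho> \<theta> 1)
                  else (reflect (I_ivl \<rho> \<theta> j), J_ivl \<rho> \<theta> (-1))))"

definition midpt :: "ivl \<Rightarrow> real" where
  "midpt K = (fst K + snd K) / 2"

definition half :: "bool \<Rightarrow> ivl \<Rightarrow> ivl" where
  "half b K = (if b then (midpt K, snd K) else (fst K, midpt K))"

definition half_bit :: "real \<Rightarrow> ivl \<Rightarrow> bool" where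
  "half_bit x K \<longleftrightarrow> midpt K < x"

text \<open>The current rectangle is a function of the transcript alone, hence known to both nodes.\<close>

fun current_rect :: "real \<Rightarrow> real \<Rightarrow> transcript \<Rightarrow> rect" where
  "current_rect \<rho> \<theta> (u2, u1, bs) =
     foldl (\<lambda>(h, v) (b2, b1). (half b1 h, half b2 v)) (first_rect \<rho> \<theta> u2 u1) bs"

fun next_round :: "real \<Rightarrow> real \<Rightarrow> real \<times> real \<Rightarrow> transcript \<Rightarrow> transcript" where
  "next_round \<rho> \<theta> (x1, x2) (u2, u1, bs) =
     (let r = current_rect \<rho> \<theta> (u2, u1, bs)
      in (u2, u1, bs @ [(half_bit x2 (snd r), half_bit x1 (fst r))]))"

text \<open>The transcript after \<open>1 + k\<close> rounds if the halting rule is disregarded.\<close>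

fun transcript_after :: "real \<Rightarrow> real \<Rightarrow> real \<times> real \<Rightarrow> nat \<Rightarrow> transcript" where
  "transcript_after \<rho> \<theta> x 0 =
     (U2 \<rho> \<theta> (snd x), U1 \<rho> \<theta> (fst x) (U2 \<rho> \<theta> (snd x)), [])"
| "transcript_after \<rho> \<theta> x (Suc k) = next_round \<rho> \<theta> x (transcript_after \<rho> \<theta> x k)"

definition halts :: "real \<Rightarrow> real \<Rightarrow> real \<times> real \<Rightarrow> bool" where
  "halts \<rho> \<theta> x \<longleftrightarrow>
     (\<exists>k. error_free \<rho> \<theta> (current_rect \<rho> \<theta> (transcript_after \<rho> \<theta> x k)))"

text \<open>Meaningful only if the protocol halts on \<open>x\<close>.\<close>

definition final_transcript :: "real \<Rightarrow> real \<Rightarrow> real \<times> real \<Rightarrow> transcript" where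
  "final_transcript \<rho> \<theta> x = transcript_after \<rho> \<theta> x
     (LEAST k. error_free \<rho> \<theta> (current_rect \<rho> \<theta> (transcript_after \<rho> \<theta> x k)))"

definition Q :: "real \<Rightarrow> real \<Rightarrow> int \<Rightarrow> real" where
  "Q \<rho> \<theta> i = \<P>(x in babai_law \<rho> \<theta>. U2 \<rho> \<theta> (snd x) = i)"

definition P :: "real \<Rightarrow> real \<Rightarrow> int \<Rightarrow> real" where
  "P \<rho> \<theta> j = \<P>(x in babai_law \<rho> \<theta>.
     U1 \<rho> \<theta> (fst x) (U2 \<rho> \<theta> (snd x)) = Some j \<bar> U2 \<rho> \<theta> (snd x) = 1)"

fun bit_cost :: "real \<Rightarrow> real \<Rightarrow> transcript \<Rightarrow> real" where
  "bit_cost \<rho> \<theta> (u2, u1, bs) =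
     log 2 (1 / Q \<rho> \<theta> u2)
     + (case u1 of None \<Rightarrow> 0 | Some j \<Rightarrow> log 2 (1 / P \<rho> \<theta> j))
     + 2 * real (length bs)"

fun round_count :: "transcript \<Rightarrow> nat" where
  "round_count (u2, u1, bs) = 1 + length bs"

definition R :: "real \<Rightarrow> real \<Rightarrow> real \<times> real \<Rightarrow> real" where
  "R \<rho> \<theta> x = bit_cost \<rho> \<theta> (final_transcript \<rho> \<theta> x)"

definition N :: "real \<Rightarrow> real \<Rightarrow> real \<times> real \<Rightarrow> nat" where
  "N \<rho> \<theta> x = round_count (final_transcript \<rho> \<theta> x)"

definition entropy_vec :: "(int \<Rightarrow> real) \<Rightarrow> real" where
  "entropy_vec p = - (\<Sum>i\<in>{-1, 0, 1}. p i * log 2 (p i))"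

end

theory Submission
  imports Defs
begin

text \<open>
  Write \<open>c = \<rho> cos \<theta>\<close> and \<open>h = \<rho> sin \<theta>\<close>. The Voronoi cell of the origin is cut out by the bisectors
  of the six vectors \<open>\<plusminus>(1, 0)\<close>, \<open>\<plusminus>(c, h)\<close>, \<open>\<plusminus>(c - 1, h)\<close>. Of the seven rectangles of Round 1, the strip
  and the two middle ones lie inside the cell, and each of the four corner rectangles is cut by
  exactly one bisector, along a diagonal. Halving both sides of a rectangle cut along a diagonal
  leaves two error-free quarters and two quarters that are again cut along a diagonal. Hence the
  set of points of a corner rectangle that are undecided after \<open>k\<close> later rounds has area \<open>2\<^sup>-\<^sup>k\<close> times
  that of the rectangle, and the number of later rounds has expectation \<open>\<Sum>k. 2\<^sup>-\<^sup>k = 2\<close> there. An error-free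
  rectangle lies on one side of the bisector, so the transcript determines the closest point.
\<close>

section \<open>The Voronoi cell and the rectangles of Round 1\<close>

text \<open>The set of all closest points rather than a chosen one, so that
  \<open>nearest \<rho> \<theta> x = {p}\<close> expresses existence and uniqueness at once.\<close>

definition nearest :: "real \<Rightarrow> real \<Rightarrow> real \<times> real \<Rightarrow> (real \<times> real) set" where
  "nearest \<rho> \<theta> x = {p \<in> lat \<rho> \<theta>. x \<in> voronoi_cell \<rho> \<theta> p}"

text \<open>The open box is the interior inspected by \<open>error_free\<close>; the half-open one
  is the version whose quarters are disjoint and cover, as needed for following the
  messages.\<close>

definition open_box :: "rect \<Rightarrow> (real \<times> real) set" where
  "open_box r = {fst (fst r)<..<snd (fst r)} \<times> {fst (snd r)<..<snd (snd r)}"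

definition half_open_box :: "rect \<Rightarrow> (real \<times> real) set" where
  "half_open_box r = half_open (fst r) \<times> half_open (snd r)"

definition area :: "rect \<Rightarrow> real" where
  "area r = (snd (fst r) - fst (fst r)) * (snd (snd r) - fst (snd r))"

text \<open>Here \<open>A\<close>, \<open>B\<close>, \<open>g\<close> play the Gram matrix of two
  basis vectors and \<open>a\<close>, \<open>b\<close> the inner products of a point with them.
  Since \<open>k \<noteq> 0\<close> gives \<open>1 \<le> \<bar>k\<bar>\<close> for an integer, each
  single bound scales to \<open>k * a < k\<^sup>2 * A / 2\<close>, and a nonnegative cross term only
  enlarges the right-hand side.\<close>

lemma integer_quadratic_form_gt:
  fixes m n :: int and a b A B g :: real
  assumes "\<bar>a\<bar> < A / 2" "\<bar>b\<bar> < B / 2" and "0 \<le> of_int m * of_int n * g"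
    and "m \<noteq> 0 \<or> n \<noteq> 0"
  shows "of_int m * a + of_int n * b
    < ((of_int m)\<^sup>2 * A + 2 * of_int m * of_int n * g + (of_int n)\<^sup>2 * B) / 2"
proof -
  have le: "of_int k * x < (of_int k)\<^sup>2 * X / 2" if "\<bar>x\<bar> < X / 2" "k \<noteq> 0" for k :: int and x X :: real
  proof -
    have k1: "1 \<le> \<bar>real_of_int k\<bar>"
      using that(2) by linarith
    have "of_int k * x \<le> \<bar>real_of_int k\<bar> * \<bar>x\<bar>"
      by (metis abs_ge_self abs_mult)
    also have "\<dots> < \<bar>real_of_int k\<bar> * (X / 2)"
      using that k1 by (intro mult_strict_left_mono) auto
    also have "\<dots> \<le> (\<bar>real_of_int k\<bar> * \<bar>real_of_int k\<bar>) * (X / 2)"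
      using k1 that(1) mult_left_mono[OF k1, of "\<bar>real_of_int k\<bar>"] by (intro mult_right_mono) auto
    finally show ?thesis
      by (simp add: power2_eq_square)
  qed
  show ?thesis
    using assms(3,4) le[OF assms(1), of m] le[OF assms(2), of n]
    by (cases "m = 0"; cases "n = 0") (auto simp: algebra_simps add_divide_distrib)
qed

text \<open>Half of \<open>(norm x)\<^sup>2 - (norm (x - p))\<^sup>2\<close>: positive where
  \<open>p\<close> is nearer than the origin, negative where the origin is nearer, zero on their
  bisector.\<close>

abbreviation side :: "real \<times> real \<Rightarrow> real \<times> real \<Rightarrow> real" where
  "side p x \<equiv> inner p x - inner p p / 2"

lemma neg_half_less_iff:
  fixes x y :: real
  shows "x < - (y / 2) \<longleftrightarrow> 2 * x < - y" and "- (y / 2) < x \<longleftrightarrow> - y < 2 * x"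
  by linarith+

section \<open>The lattice parameters in coordinates \<open>c\<close> and \<open>h\<close>\<close>

locale babai =
  fixes \<rho> \<theta> :: real
  assumes rho: "1 \<le> \<rho>" and theta_pos: "0 < \<theta>" and theta_less: "\<theta> < pi / 2"
    and cos_pos: "0 < \<rho> * cos \<theta>" and cos_less: "\<rho> * cos \<theta> < 1 / 2"
begin

definition c :: real where "c = \<rho> * cos \<theta>"
definition h :: real where "h = \<rho> * sin \<theta>"

lemma c_bounds: "0 < c" "c < 1 / 2"
  using cos_pos cos_less by (auto simp: c_def)

lemma sin_pos: "0 < sin \<theta>"
  using theta_pos theta_less by (intro sin_gt_zero) auto

lemma h_pos: "0 < h"
  using sin_pos rho by (simp add: h_def)

lemma c_h_norm: "1 \<le> c\<^sup>2 + h\<^sup>2"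
proof -
  have "c\<^sup>2 + h\<^sup>2 = \<rho>\<^sup>2 * ((cos \<theta>)\<^sup>2 + (sin \<theta>)\<^sup>2)"
    by (simp only: c_def h_def power_mult_distrib distrib_left)
  then show ?thesis
    using rho by simp
qed

text \<open>Equivalently, \<open>(c, h)\<close> and \<open>(c - 1, h)\<close> have positive inner
  product. It follows from \<open>c < 1\<close> and
  \<open>1 \<le> c\<^sup>2 + h\<^sup>2\<close>.\<close>

lemma c_h_obtuse: "c * (1 - c) < h\<^sup>2"
  using c_bounds c_h_norm by (simp add: power2_eq_square algebra_simps)

lemma cell_height_eq: "cell_height \<rho> \<theta> = h"
  by (simp add: cell_height_def h_def)

text \<open>The bisectors of \<open>(c, h)\<close> and \<open>(c - 1, h)\<close> have slopes
  \<open>- c / h\<close> and \<open>(1 - c) / h\<close>. Over the corner widths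
  \<open>(1 - c) / 2\<close> and \<open>c / 2\<close> both change height by this same amount, so one
  height serves all corner rectangles.\<close>

lemma H1_eq: "H1 \<rho> \<theta> = c * (1 - c) / (2 * h)"
  using rho sin_pos by (simp add: H1_def c_def h_def)

lemma h_H1: "h * H1 \<rho> \<theta> = c * (1 - c) / 2"
  using h_pos by (simp add: H1_eq)

lemma H1_bounds: "0 < H1 \<rho> \<theta>" "H1 \<rho> \<theta> < h / 2"
proof -
  show "0 < H1 \<rho> \<theta>"
    using c_bounds h_pos by (simp add: H1_eq)
  have "h * H1 \<rho> \<theta> < h * (h / 2)"
    using c_h_obtuse by (simp add: h_H1 power2_eq_square)
  then show "H1 \<rho> \<theta> < h / 2"
    using h_pos by (simp only: mult_less_cancel_left_pos)
qed

lemma tau1_eq: "tau1 \<rho> \<theta> = h / 2 - H1 \<rho> \<theta>"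
  by (simp add: tau1_def cell_height_eq)

lemma tau1_bounds: "0 < tau1 \<rho> \<theta>" "tau1 \<rho> \<theta> < h / 2"
  using H1_bounds by (auto simp: tau1_eq)

lemma h_tau1: "h * tau1 \<rho> \<theta> = (h\<^sup>2 - c * (1 - c)) / 2"
  using h_H1 by (simp add: tau1_eq right_diff_distrib power2_eq_square diff_divide_distrib)

lemma t_eq: "t_m2 \<rho> \<theta> = (c - 1) / 2" "t_1 \<rho> \<theta> = c / 2"
  by (auto simp: t_m2_def t_1_def c_def)

section \<open>Closest lattice points near the origin\<close>

lemma mem_lat_iff: "q \<in> lat \<rho> \<theta> \<longleftrightarrow> (\<exists>m n :: int. q = (of_int m + of_int n * c, of_int n * h))"
  by (auto simp: lat_def c_def h_def)

lemma lat_diff: "p \<in> lat \<rho> \<theta> \<Longrightarrow> q \<in> lat \<rho> \<theta> \<Longrightarrow> q - p \<in> lat \<rho> \<theta>"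
  unfolding mem_lat_iff
proof (elim exE, goal_cases)
  case (1 m m' n n')
  then show ?case
    by (intro exI[of _ "m' - m"] exI[of _ "n' - n"]) (auto simp: algebra_simps)
qed

text \<open>The open hexagon bounded by the six bisectors. Strict inequalities make it open and keep
  ties out.\<close>

definition core :: "(real \<times> real) set" where
  "core = {(x, y). \<bar>x\<bar> < 1 / 2 \<and> \<bar>c * x + h * y\<bar> < (c\<^sup>2 + h\<^sup>2) / 2
     \<and> \<bar>(c - 1) * x + h * y\<bar> < ((1 - c)\<^sup>2 + h\<^sup>2) / 2}"

text \<open>The vectors \<open>(1, 0)\<close>, \<open>(c - 1, h)\<close>, \<open>(-c, -h)\<close> form an obtuse superbase, so every lattice
  vector is a combination of two of them, up to sign, along which the quadratic form has no
  negative cross term.\<close>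

lemma core_inner_less:
  fixes m n :: int
  assumes "(x, y) \<in> core" and "m \<noteq> 0 \<or> n \<noteq> 0"
  shows "(of_int m + of_int n * c) * x + of_int n * h * y
    < ((of_int m + of_int n * c)\<^sup>2 + (of_int n * h)\<^sup>2) / 2"
proof -
  let ?m = "real_of_int m" and ?n = "real_of_int n"
  have x: "\<bar>x\<bar> < 1 / 2" and y: "\<bar>c * x + h * y\<bar> < (c\<^sup>2 + h\<^sup>2) / 2"
    and xy: "\<bar>(c - 1) * x + h * y\<bar> < ((1 - c)\<^sup>2 + h\<^sup>2) / 2"
    using assms(1) by (auto simp: core_def)
  \<comment> \<open>If all three failed, \<open>m + n\<close> would share its sign with both
    \<open>m\<close> and \<open>n\<close>, whose signs are opposite.\<close>
  have "0 \<le> ?m * ?n \<or> (?m + ?n) * ?n \<le> 0 \<or> (?m + ?n) * ?m \<le> 0"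
  proof (rule ccontr)
    assume a: "\<not> ?thesis"
    then have "?m * ?n < 0" "0 < (?m + ?n) * ?n" "0 < (?m + ?n) * ?m"
      by auto
    then show False
      by (auto simp: mult_less_0_iff zero_less_mult_iff)
  qed
  then consider "0 \<le> ?m * ?n" | "(?m + ?n) * ?n \<le> 0" | "(?m + ?n) * ?m \<le> 0"
    by blast
  then show ?thesis
  proof cases
    case 1
    then have "0 \<le> ?m * ?n * c"
      using c_bounds by simp
    from integer_quadratic_form_gt[OF x y this assms(2)] show ?thesis
      by (simp add: power2_eq_square algebra_simps)
  next
    case 2
    have nz: "m + n \<noteq> 0 \<or> n \<noteq> 0"
      using assms(2) by auto
    \<comment> \<open>With respect to \<open>(1, 0)\<close> and \<open>(c - 1, h)\<close> the
      coefficients are \<open>m + n\<close> and \<open>n\<close>, and the inner product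
      \<open>c - 1\<close> is negative.\<close>
    have "0 \<le> of_int (m + n) * ?n * (c - 1)"
      using 2 c_bounds by (simp add: mult_nonpos_nonpos)
    from integer_quadratic_form_gt[OF x xy this nz] show ?thesis
      by (simp add: power2_eq_square algebra_simps)
  next
    case 3
    \<comment> \<open>With respect to \<open>(c, h)\<close> and \<open>(c - 1, h)\<close> the
      coefficients are \<open>m + n\<close> and \<open>- m\<close>, and the inner product is
      positive by \<open>c_h_obtuse\<close>.\<close>
    have "0 \<le> - ((?m + ?n) * ?m) * (h\<^sup>2 - c * (1 - c))"
      using 3 c_h_obtuse by (intro mult_nonneg_nonneg) auto
    then have "0 \<le> of_int (m + n) * of_int (- m) * (h\<^sup>2 - c * (1 - c))"
      by simp
    moreover have "m + n \<noteq> 0 \<or> - m \<noteq> 0"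
      using assms(2) by auto
    ultimately show ?thesis
      using integer_quadratic_form_gt[OF y xy, of "m + n" "- m" "h\<^sup>2 - c * (1 - c)"]
      by (simp add: power2_eq_square algebra_simps)
  qed
qed

text \<open>Expanding \<open>(norm (x - q))\<^sup>2\<close> around \<open>p\<close> reduces the
  comparison to \<open>core_inner_less\<close> for the nonzero lattice vector
  \<open>q - p\<close>.\<close>

lemma core_closest:
  assumes "p \<in> lat \<rho> \<theta>" "x - p \<in> core" "q \<in> lat \<rho> \<theta>" "q \<noteq> p"
  shows "dist x p < dist x q"
proof -
  obtain m n :: int where mn: "q - p = (of_int m + of_int n * c, of_int n * h)"
    using lat_diff[OF assms(1,3)] unfolding mem_lat_iff by blast
  have nz: "m \<noteq> 0 \<or> n \<noteq> 0"
    using mn assms(4) by (auto simp: zero_prod_def[symmetric])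
  obtain u v where uv: "x - p = (u, v)"
    by force
  have "inner (x - p) (q - p) < (norm (q - p))\<^sup>2 / 2"
    using core_inner_less[OF assms(2)[unfolded uv] nz]
    by (simp add: mn uv norm_prod_def algebra_simps)
  moreover have "(norm (x - q))\<^sup>2 = (norm (x - p))\<^sup>2 - 2 * inner (x - p) (q - p) + (norm (q - p))\<^sup>2"
    by (simp add: power2_norm_eq_inner inner_diff inner_commute algebra_simps)
  ultimately have "(norm (x - p))\<^sup>2 < (norm (x - q))\<^sup>2"
    by simp
  then show ?thesis
    unfolding dist_norm by (rule power2_less_imp_less) simp
qed

lemma nearest_core:
  assumes "p \<in> lat \<rho> \<theta>" "x - p \<in> core"
  shows "nearest \<rho> \<theta> x = {p}"
  unfolding nearest_def voronoi_cell_def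
proof (intro equalityI subsetI)
  fix q assume "q \<in> {q \<in> lat \<rho> \<theta>. x \<in> {x. \<forall>q'\<in>lat \<rho> \<theta>. dist x q \<le> dist x q'}}"
  then have "q \<in> lat \<rho> \<theta>" "dist x q \<le> dist x p"
    using assms(1) by auto
  then show "q \<in> {p}"
    using core_closest[OF assms, of q] by force
next
  fix q assume "q \<in> {p}"
  moreover have "dist x p \<le> dist x q'" if "q' \<in> lat \<rho> \<theta>" for q'
    using core_closest[OF assms that] by (cases "q' = p") auto
  ultimately show "q \<in> {q \<in> lat \<rho> \<theta>. x \<in> {x. \<forall>q'\<in>lat \<rho> \<theta>. dist x q \<le> dist x q'}}"
    using assms(1) by simp
qed

lemma zero_in_lat: "(0, 0) \<in> lat \<rho> \<theta>"
  unfolding mem_lat_iff by (intro exI[of _ 0]) simp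

lemma open_core: "open core"
  unfolding core_def case_prod_unfold
  by (intro open_Collect_conj open_Collect_less continuous_intros)

lemma nearest_zero: "x \<in> core \<Longrightarrow> nearest \<rho> \<theta> x = {(0, 0)}"
  using nearest_core[OF zero_in_lat, of x] by (simp add: zero_prod_def[symmetric])

lemma core_subset_voronoi: "core \<subseteq> voronoi_cell \<rho> \<theta> (0, 0)"
  using nearest_zero by (fastforce simp: nearest_def)

text \<open>An open subset of a set lies in its interior and so misses its frontier. Boxes inside
  \<open>core\<close> are therefore error-free.\<close>

lemma frontier_voronoi_core: "core \<inter> frontier (voronoi_cell \<rho> \<theta> (0, 0)) = {}"
  using interior_maximal[OF core_subset_voronoi open_core] by (auto simp: frontier_def)

text \<open>The lattice point competing with the origin on the corner rectangle with messages
  \<open>i\<close> and \<open>j\<close>; the factor \<open>i\<close> accounts for the reflection of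
  the lower row.\<close>

definition corner_point :: "int \<Rightarrow> int \<Rightarrow> real \<times> real" where
  "corner_point i j = of_int i *\<^sub>R (if j = 1 then (c, h) else (c - 1, h))"

lemma corner_point_in_lat: "corner_point i j \<in> lat \<rho> \<theta>"
  unfolding mem_lat_iff corner_point_def
  by (intro exI[of _ "if j = 1 then 0 else - i"] exI[of _ i]) (auto simp: algebra_simps)

section \<open>The corner rectangles of Round 1\<close>

lemmas rect_defs = first_rect_def I_ivl_def J_ivl_def reflect_def cell_height_eq t_eq

text \<open>The products enter as separate variables, which leaves only linear conditions to
  check.\<close>

lemma coreI:
  assumes "cx = c * x" "hy = h * y" "cc = c * c" "hh = h * h" "- 1 / 2 < x" "x < 1 / 2"
    and "- (cc + hh) < 2 * (cx + hy)" "2 * (cx + hy) < cc + hh"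
    and "2 * c - 1 - cc - hh < 2 * (cx - x + hy)" "2 * (cx - x + hy) < 1 - 2 * c + cc + hh"
  shows "(x, y) \<in> core"
proof -
  have eqs: "c * x + h * y = cx + hy" "(c - 1) * x + h * y = cx - x + hy"
    "(1 - c)\<^sup>2 + h\<^sup>2 = 1 - 2 * c + cc + hh" "c\<^sup>2 + h\<^sup>2 = cc + hh"
    using assms(1-4) by (simp_all add: power2_eq_square algebra_simps)
  show ?thesis
    unfolding core_def mem_Collect_eq case_prod_conv abs_less_iff eqs
    using assms(5-) by auto
qed

text \<open>The bounds of a corner rectangle settle every inequality of \<open>core\<close> except
  the one for the bisector of the corner point, which the sign of \<open>side\<close> supplies. The
  same holds for the translate by that point, where the opposite sign is the right one.\<close>

lemma corner_core:
  assumes ij: "i \<in> {-1, 1}" "j \<in> {-1, 1}"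
    and x: "x \<in> open_box (first_rect \<rho> \<theta> i (Some j))"
  shows "side (corner_point i j) x < 0 \<Longrightarrow> x \<in> core"
    and "0 < side (corner_point i j) x \<Longrightarrow> x - corner_point i j \<in> core"
proof -
  obtain u v where uv: "x = (u, v)"
    by force
  have u: "fst (fst (first_rect \<rho> \<theta> i (Some j))) < u" "u < snd (fst (first_rect \<rho> \<theta> i (Some j)))"
    and v: "fst (snd (first_rect \<rho> \<theta> i (Some j))) < v" "v < snd (snd (first_rect \<rho> \<theta> i (Some j)))"
    using x by (auto simp: uv open_box_def)
  note uv_scaled = mult_strict_left_mono[OF u(1) c_bounds(1)] mult_strict_left_mono[OF u(2) c_bounds(1)]
    mult_strict_left_mono[OF v(1) h_pos] mult_strict_left_mono[OF v(2) h_pos]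
  define cu hv cc hh where "cu = c * u" and "hv = h * v" and "cc = c * c" and "hh = h * h"
  note defs = cu_def hv_def cc_def hh_def
  have c_sq: "c * c < c / 2" "0 < c * c"
    using c_bounds by auto
  have t: "h * tau1 \<rho> \<theta> = (h * h - c + c * c) / 2"
    using h_tau1 by (simp add: power2_eq_square algebra_simps)
  have o: "c - c * c < h * h" "1 - c * c \<le> h * h"
    using c_h_obtuse c_h_norm by (simp_all add: power2_eq_square algebra_simps)
  have sd: "2 * side (corner_point 1 1) x = 2 * (c * u + h * v) - (c * c + h * h)"
    "2 * side (corner_point 1 (-1)) x = 2 * (c * u - u + h * v) - (1 - 2 * c + c * c + h * h)"
    "2 * side (corner_point (-1) 1) x = - 2 * (c * u + h * v) - (c * c + h * h)"
    "2 * side (corner_point (-1) (-1)) x = 2 * (u - c * u - h * v) - (1 - 2 * c + c * c + h * h)"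
    by (simp_all add: uv corner_point_def field_simps)
  have bnd: "if i = 1 then (h * h - c + c * c) / 2 < h * v \<and> h * v < h * h / 2
    else - (h * h) / 2 < h * v \<and> 2 * (h * v) < - (h * h - c + c * c)"
    using ij uv_scaled(3,4) by (auto simp: rect_defs t neg_half_less_iff)
  have bnd': "if j = 1 then (if i = 1 then c / 2 < u \<and> u < 1 / 2 \<and> c * c / 2 < c * u \<and> c * u < c / 2
        else - 1 / 2 < u \<and> u < - c / 2 \<and> - c / 2 < c * u \<and> c * u < - (c * c) / 2)
    else (if i = 1 then - 1 / 2 < u \<and> u < (c - 1) / 2 \<and> - c / 2 < c * u \<and> c * u < (c * c - c) / 2
        else (1 - c) / 2 < u \<and> u < 1 / 2 \<and> (c - c * c) / 2 < c * u \<and> c * u < c / 2)"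
    using ij u uv_scaled(1,2) by (auto simp: rect_defs field_simps)
  \<comment> \<open>The bisectors of \<open>(c - 1, h)\<close> and its negative involve
    \<open>c * u - u\<close>. Scaling the bounds on \<open>u\<close> by \<open>1 - c\<close> and
    negating bounds it more sharply than combining separate bounds on \<open>c * u\<close> and
    \<open>u\<close>.\<close>
  have bnd2: "if j = 1 then (if i = 1 then (c - 1) / 2 < c * u - u \<and> c * u - u < (c * c - c) / 2
        else (c - c * c) / 2 < c * u - u \<and> c * u - u < (1 - c) / 2)
    else (if i = 1 then (1 - 2 * c + c * c) / 2 < c * u - u \<and> c * u - u < (1 - c) / 2
        else (c - 1) / 2 < c * u - u \<and> c * u - u < - (1 - 2 * c + c * c) / 2)"
    using ij mult_strict_left_mono[OF u(1), of "1 - c"] mult_strict_left_mono[OF u(2), of "1 - c"] c_bounds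
    by (auto simp: rect_defs field_simps)
  note facts = bnd bnd' bnd2 c_sq c_bounds o
  note facts = facts[folded defs] and sd = sd[folded defs]
  have less_half: "X < Y" if "a < 0" "2 * a = X - Y" for a X Y :: real
    using that by linarith
  have greater_half: "Y < X" if "0 < a" "2 * a = X - Y" for a X Y :: real
    using that by linarith
  consider "i = 1" "j = 1" | "i = 1" "j = -1" | "i = -1" "j = 1" | "i = -1" "j = -1"
    using ij by blast
  then have "(side (corner_point i j) x < 0 \<longrightarrow> x \<in> core)
    \<and> (0 < side (corner_point i j) x \<longrightarrow> x - corner_point i j \<in> core)"
  proof cases
    case 1
    note facts' = facts[unfolded 1, simplified]
    have "x \<in> core" if "side (corner_point i j) x < 0"
    proof -
      have "2 * (cu + hv) < cc + hh"
        by (rule less_half[OF that[unfolded 1] sd(1)])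
      with facts' show ?thesis
        unfolding uv by (elim conjE) (intro coreI[OF defs]; (linarith | simp))
    qed
    moreover have "x - corner_point i j \<in> core" if "0 < side (corner_point i j) x"
    proof -
      have eqs: "cu - cc = c * (u - c)" "hv - hh = h * (v - h)"
        by (simp_all add: defs algebra_simps)
      have "cc + hh < 2 * (cu + hv)"
        by (rule greater_half[OF that[unfolded 1] sd(1)])
      with facts' have "(u - c, v - h) \<in> core"
        by (elim conjE) (intro coreI[OF eqs cc_def hh_def]; (linarith | simp))
      then show ?thesis
        using 1 by (simp add: uv corner_point_def algebra_simps)
    qed
    ultimately show ?thesis
      by blast
  next
    case 2
    note facts' = facts[unfolded 2, simplified]
    have "x \<in> core" if "side (corner_point i j) x < 0"
    proof -
      have "2 * (cu - u + hv) < 1 - 2 * c + cc + hh"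
        by (rule less_half[OF that[unfolded 2] sd(2)])
      with facts' show ?thesis
        unfolding uv by (elim conjE) (intro coreI[OF defs]; (linarith | simp))
    qed
    moreover have "x - corner_point i j \<in> core" if "0 < side (corner_point i j) x"
    proof -
      have eqs: "cu - cc + c = c * (u - (c - 1))" "hv - hh = h * (v - h)"
        by (simp_all add: defs algebra_simps)
      have "1 - 2 * c + cc + hh < 2 * (cu - u + hv)"
        by (rule greater_half[OF that[unfolded 2] sd(2)])
      with facts' have "(u - (c - 1), v - h) \<in> core"
        by (elim conjE) (intro coreI[OF eqs cc_def hh_def]; (linarith | simp))
      then show ?thesis
        using 2 by (simp add: uv corner_point_def algebra_simps)
    qed
    ultimately show ?thesis
      by blast
  next
    case 3
    note facts' = facts[unfolded 3, simplified]
    have "x \<in> core" if "side (corner_point i j) x < 0"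
    proof -
      have "- 2 * (cu + hv) < cc + hh"
        by (rule less_half[OF that[unfolded 3] sd(3)])
      with facts' show ?thesis
        unfolding uv by (elim conjE) (intro coreI[OF defs]; (linarith | simp))
    qed
    moreover have "x - corner_point i j \<in> core" if "0 < side (corner_point i j) x"
    proof -
      have eqs: "cu + cc = c * (u + c)" "hv + hh = h * (v + h)"
        by (simp_all add: defs algebra_simps)
      have "cc + hh < - 2 * (cu + hv)"
        by (rule greater_half[OF that[unfolded 3] sd(3)])
      with facts' have "(u + c, v + h) \<in> core"
        by (elim conjE) (intro coreI[OF eqs cc_def hh_def]; (linarith | simp))
      then show ?thesis
        using 3 by (simp add: uv corner_point_def algebra_simps)
    qed
    ultimately show ?thesis
      by blast
  next
    case 4
    note facts' = facts[unfolded 4, simplified]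
    have "x \<in> core" if "side (corner_point i j) x < 0"
    proof -
      have "2 * (u - cu - hv) < 1 - 2 * c + cc + hh"
        by (rule less_half[OF that[unfolded 4] sd(4)])
      with facts' show ?thesis
        unfolding uv by (elim conjE) (intro coreI[OF defs]; (linarith | simp))
    qed
    moreover have "x - corner_point i j \<in> core" if "0 < side (corner_point i j) x"
    proof -
      have eqs: "cu + cc - c = c * (u + (c - 1))" "hv + hh = h * (v + h)"
        by (simp_all add: defs algebra_simps)
      have "1 - 2 * c + cc + hh < 2 * (u - cu - hv)"
        by (rule greater_half[OF that[unfolded 4] sd(4)])
      with facts' have "(u + (c - 1), v + h) \<in> core"
        by (elim conjE) (intro coreI[OF eqs cc_def hh_def]; (linarith | simp))
      then show ?thesis
        using 4 by (simp add: uv corner_point_def algebra_simps)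
    qed
    ultimately show ?thesis
      by blast
  qed
  then show "side (corner_point i j) x < 0 \<Longrightarrow> x \<in> core"
    and "0 < side (corner_point i j) x \<Longrightarrow> x - corner_point i j \<in> core"
    by blast+
qed

end

section \<open>Halving a rectangle cut along a diagonal\<close>

definition quad :: "bool \<Rightarrow> bool \<Rightarrow> rect \<Rightarrow> rect" where
  "quad b1 b2 r = (half b1 (fst r), half b2 (snd r))"

text \<open>One later round as a map on rectangles alone; \<open>k\<close> later rounds become an
  iterate of it.\<close>

definition refine :: "real \<times> real \<Rightarrow> rect \<Rightarrow> rect" where
  "refine x r = quad (half_bit (fst x) (fst r)) (half_bit (snd x) (snd r)) r"

definition nondegenerate :: "rect \<Rightarrow> bool" where
  "nondegenerate r \<longleftrightarrow> fst (fst r) < snd (fst r) \<and> fst (snd r) < snd (snd r)"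

lemma nondegenerate_quad: "nondegenerate r \<Longrightarrow> nondegenerate (quad b1 b2 r)"
  by (auto simp: nondegenerate_def quad_def half_def midpt_def)

lemma area_quad: "area (quad b1 b2 r) = area r / 4"
  by (auto simp: area_def quad_def half_def midpt_def field_simps)

lemma open_box_quad_subset: "nondegenerate r \<Longrightarrow> open_box (quad b1 b2 r) \<subseteq> open_box r"
  by (auto simp: nondegenerate_def open_box_def quad_def half_def midpt_def split: if_splits)

text \<open>A point on a midline gets bit \<open>False\<close>, in agreement with intervals closed
  on the right. The quarters thus partition the box exactly, without exceptional null sets.\<close>

lemma mem_half_open_box_quad:
  assumes "nondegenerate r"
  shows "x \<in> half_open_box (quad b1 b2 r)
    \<longleftrightarrow> x \<in> half_open_box r \<and> b1 = half_bit (fst x) (fst r) \<and> b2 = half_bit (snd x) (snd r)"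
  using assms
  by (cases x; cases b1; cases b2)
    (auto simp: nondegenerate_def half_open_box_def half_open_def quad_def half_def half_bit_def midpt_def)

lemma emeasure_half_open_box:
  assumes "nondegenerate r"
  shows "emeasure lborel (half_open_box r) = ennreal (area r)"
proof -
  have "emeasure lborel (half_open_box r)
      = emeasure lborel {fst (fst r)<..snd (fst r)} * emeasure lborel {fst (snd r)<..snd (snd r)}"
    unfolding half_open_box_def half_open_def lborel_prod[symmetric]
    by (rule lborel.emeasure_pair_measure_Times) auto
  then show ?thesis
    using assms by (simp add: nondegenerate_def area_def ennreal_mult[symmetric])
qed

lemma half_open_box_borel [measurable]: "half_open_box r \<in> sets borel"
  unfolding half_open_box_def half_open_def borel_prod[symmetric]
  by (intro pair_measureI) auto

section \<open>Error-free rectangles under refinement\<close>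

lemma error_free_iff:
  "error_free \<rho> \<theta> r \<longleftrightarrow> open_box r \<inter> frontier (voronoi_cell \<rho> \<theta> (0, 0)) = {}"
  by (simp add: error_free_def open_box_def interior_Times)

lemma open_open_box: "open (open_box r)"
  by (simp add: open_box_def open_Times)

lemma convex_open_box: "convex (open_box r)"
  by (simp add: open_box_def convex_Times)

lemma nondegenerate_refine: "nondegenerate r \<Longrightarrow> nondegenerate ((refine x ^^ k) r)"
  by (induction k) (auto simp: refine_def nondegenerate_quad)

lemma open_box_refine_subset: "nondegenerate r \<Longrightarrow> open_box ((refine x ^^ k) r) \<subseteq> open_box r"
proof (induction k)
  case (Suc k)
  have "open_box (refine x ((refine x ^^ k) r)) \<subseteq> open_box ((refine x ^^ k) r)"
    unfolding refine_def[of x "(refine x ^^ k) r"]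
    by (rule open_box_quad_subset[OF nondegenerate_refine[OF Suc.prems]])
  with Suc show ?case
    by auto
qed simp

text \<open>Smaller boxes inherit error-freeness, so the process may be followed past its halting
  time without becoming undecided again.\<close>

lemma error_free_refine:
  assumes "nondegenerate r" "error_free \<rho> \<theta> r"
  shows "error_free \<rho> \<theta> ((refine x ^^ k) r)"
  using open_box_refine_subset[OF assms(1), of k x] assms(2) by (auto simp: error_free_iff)

text \<open>The bisector of \<open>0\<close> and \<open>p\<close> passes through two opposite corners: lower left and upper right if
  \<open>b\<close>, upper left and lower right otherwise.\<close>

definition diagonal :: "bool \<Rightarrow> real \<times> real \<Rightarrow> rect \<Rightarrow> bool" where
  "diagonal b p r \<longleftrightarrow> nondegenerate r \<and> p \<noteq> 0
     \<and> side p (fst (fst r), if b then fst (snd r) else snd (snd r)) = 0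
     \<and> side p (snd (fst r), if b then snd (snd r) else fst (snd r)) = 0"

text \<open>The centre lies on the diagonal, so the two quarters along it are cut by the same line
  between corners of the same kind.\<close>

lemma diagonal_quad: "diagonal b p r \<Longrightarrow> diagonal b p (quad b1 (b1 = b) r)"
  by (cases b1; cases b)
    (auto simp: diagonal_def nondegenerate_def quad_def half_def midpt_def inner_prod_def field_simps)

text \<open>\<open>side p\<close> is affine and vanishes at the centre, which is the average of the
  two corners on the bisector.\<close>

lemma side_midpt:
  assumes "diagonal b p r"
  shows "side p y = fst p * (fst y - midpt (fst r)) + snd p * (snd y - midpt (snd r))"
  using assms
  by (cases b) (auto simp: diagonal_def midpt_def inner_prod_def field_simps)

text \<open>Subtracting the two corner equations relates \<open>fst p\<close> to
  \<open>snd p\<close> through the positive width and height; the orientation \<open>b\<close>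
  decides the sign.\<close>

lemma diagonal_slope:
  assumes "diagonal b p r"
  shows "if b then fst p * snd p < 0 else 0 < fst p * snd p"
proof -
  define v w where "v = snd (fst r) - fst (fst r)" and "w = snd (snd r) - fst (snd r)"
  have vw: "0 < v" "0 < w" and p: "p \<noteq> 0"
    using assms by (auto simp: diagonal_def nondegenerate_def v_def w_def)
  have eq: "fst p * v + (if b then 1 else - 1) * (snd p * w) = 0"
    using assms by (cases b) (auto simp: diagonal_def v_def w_def inner_prod_def algebra_simps)
  have "snd p \<noteq> 0"
    using eq vw p by (auto simp: prod_eq_iff)
  then have "0 < snd p * snd p * w"
    using vw by (simp add: zero_less_mult_iff) linarith
  \<comment> \<open>Multiplying the relation by \<open>snd p\<close> turns it into a statement about
    the product, whose sign is then that of a multiple of a square.\<close>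
  moreover have "fst p * snd p * v = - ((if b then 1 else - 1) * (snd p * snd p * w))"
    using arg_cong[OF eq, of "\<lambda>z. z * snd p"] by (simp add: algebra_simps)
  ultimately have "if b then fst p * snd p * v < 0 * v else 0 * v < fst p * snd p * v"
    by (cases b) (simp_all only: if_True if_False mult_zero_left mult_1_left mult_minus_left neg_less_0_iff_less minus_minus)
  then show ?thesis
    by (simp only: mult_less_cancel_right_pos[OF vw(1)])
qed

text \<open>Measured from the centre, the two terms of \<open>side p y\<close> have the same strict
  sign in a quarter off the diagonal, so they cannot cancel.\<close>

lemma side_off_diagonal:
  assumes "diagonal b p r" "(b1 = b2) \<noteq> b" "y \<in> open_box (quad b1 b2 r)"
  shows "side p y \<noteq> 0"
proof -
  define s t where "s = fst y - midpt (fst r)" and "t = snd y - midpt (snd r)"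
  have st: "if b1 then 0 < s else s < 0" "if b2 then 0 < t else t < 0"
    using assms(3) by (auto simp: open_box_def quad_def half_def s_def t_def split: if_splits)
  have "side p y = fst p * s + snd p * t"
    unfolding s_def t_def by (rule side_midpt[OF assms(1)])
  moreover have "fst p * s + snd p * t \<noteq> 0"
  proof
    assume "fst p * s + snd p * t = 0"
    then have "fst p * s = - (snd p * t)"
      by simp
    then have "(fst p * s) * (snd p * t) = - (snd p * t)\<^sup>2"
      by (simp add: power2_eq_square)
    moreover have "(fst p * snd p) * (s * t) = (fst p * s) * (snd p * t)"
      by (simp add: mult_ac)
    ultimately have "(fst p * snd p) * (s * t) \<le> 0"
      by (simp only: neg_le_0_iff_le zero_le_power2)
    moreover have "0 < (fst p * snd p) * (s * t)"
      using diagonal_slope[OF assms(1)] st assms(2)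
      by (cases b; cases b1; cases b2) (auto simp: zero_less_mult_iff mult_less_0_iff)
    ultimately show False
      by simp
  qed
  ultimately show ?thesis
    by simp
qed

text \<open>Induction with \<open>r\<close> arbitrary: only the two quarters along the diagonal can
  stay undecided, each has a quarter of the area and satisfies the hypotheses again, so the
  undecided area halves per round. Measurability is carried along for additivity.\<close>

lemma emeasure_undecided:
  assumes "diagonal b p r"
    and "\<And>y. y \<in> open_box r \<Longrightarrow> y \<in> frontier (voronoi_cell \<rho> \<theta> (0, 0)) \<longleftrightarrow> side p y = 0"
  shows "{x \<in> half_open_box r. \<not> error_free \<rho> \<theta> ((refine x ^^ k) r)} \<in> sets borel
    \<and> emeasure lborel {x \<in> half_open_box r. \<not> error_free \<rho> \<theta> ((refine x ^^ k) r)} = ennreal (area r / 2 ^ k)"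
  using assms
proof (induction k arbitrary: r)
  case 0
  have nd: "nondegenerate r"
    using 0(1) by (simp add: diagonal_def)
  let ?m = "(midpt (fst r), midpt (snd r))"
  have m: "?m \<in> open_box r"
    using nd by (simp add: nondegenerate_def open_box_def midpt_def)
  \<comment> \<open>The centre witnesses that the bisector meets the open box, so nothing is decided
    before the first halving.\<close>
  have "side p ?m = 0"
    unfolding side_midpt[OF 0(1)] by simp
  then have "\<not> error_free \<rho> \<theta> r"
    using 0(2)[OF m] m by (auto simp: error_free_iff)
  then show ?case
    by (simp add: emeasure_half_open_box[OF nd])
next
  case (Suc k)
  have nd: "nondegenerate r"
    using Suc.prems(1) by (simp add: diagonal_def)
  \<comment> \<open>The undecided part of a diagonal quarter: there the second bit is forced to be
    \<open>b1 = b\<close>.\<close>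
  define A where "A b1 = {x \<in> half_open_box (quad b1 (b1 = b) r).
    \<not> error_free \<rho> \<theta> ((refine x ^^ k) (quad b1 (b1 = b) r))}" for b1
  have IH: "A b1 \<in> sets borel" "emeasure lborel (A b1) = ennreal (area r / 4 / 2 ^ k)" for b1
    using Suc.IH[OF diagonal_quad[OF Suc.prems(1)] Suc.prems(2), of b1] open_box_quad_subset[OF nd]
    by (auto simp: A_def area_quad)
  have off: "error_free \<rho> \<theta> ((refine x ^^ k) (quad b1 b2 r))" if "(b1 = b2) \<noteq> b" for x b1 b2
  proof (rule error_free_refine[OF nondegenerate_quad[OF nd]])
    show "error_free \<rho> \<theta> (quad b1 b2 r)"
      unfolding error_free_iff
      using side_off_diagonal[OF Suc.prems(1) that] Suc.prems(2) open_box_quad_subset[OF nd] by blast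
  qed
  have "{x \<in> half_open_box r. \<not> error_free \<rho> \<theta> ((refine x ^^ Suc k) r)} = A True \<union> A False"
  proof (intro set_eqI iffI)
    fix x assume x: "x \<in> {x \<in> half_open_box r. \<not> error_free \<rho> \<theta> ((refine x ^^ Suc k) r)}"
    define b1 b2 where "b1 = half_bit (fst x) (fst r)" and "b2 = half_bit (snd x) (snd r)"
    have "(refine x ^^ Suc k) r = (refine x ^^ k) (quad b1 b2 r)"
      by (simp add: funpow_swap1 refine_def b1_def b2_def)
    then have "b2 = (b1 = b)" "\<not> error_free \<rho> \<theta> ((refine x ^^ k) (quad b1 b2 r))"
      using x off[of b1 b2 x] by auto
    then have "x \<in> A b1"
      using x by (simp add: A_def mem_half_open_box_quad[OF nd] b1_def b2_def)
    then show "x \<in> A True \<union> A False"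
      by (cases b1) auto
  next
    fix x assume "x \<in> A True \<union> A False"
    then show "x \<in> {x \<in> half_open_box r. \<not> error_free \<rho> \<theta> ((refine x ^^ Suc k) r)}"
      by (auto simp: A_def mem_half_open_box_quad[OF nd] funpow_swap1 refine_def)
  qed
  moreover have "A True \<inter> A False = {}"
    by (auto simp: A_def mem_half_open_box_quad[OF nd])
  moreover have "emeasure lborel (A True \<union> A False) = emeasure lborel (A True) + emeasure lborel (A False)"
    using IH(1) \<open>A True \<inter> A False = {}\<close> by (intro plus_emeasure[symmetric]) auto
  moreover have "0 < area r"
    using nd by (simp add: area_def nondegenerate_def)
  then have "ennreal (area r / 4 / 2 ^ k) + ennreal (area r / 4 / 2 ^ k) = ennreal (area r / 2 ^ Suc k)"
    by (subst ennreal_plus[symmetric]) (auto simp: field_simps)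
  ultimately show ?case
    using IH by auto
qed

section \<open>The frontier of the Voronoi cell inside the seven rectangles\<close>

context babai
begin

text \<open>Off the bisector, a point lies either in the open set \<open>core\<close> or in an open
  set disjoint from the cell. On it, small moves along \<open>- p\<close> and \<open>p\<close>, for
  the corner point \<open>p\<close>, reach points inside and outside the cell.\<close>

lemma corner_frontier:
  assumes ij: "i \<in> {-1, 1}" "j \<in> {-1, 1}"
    and x: "x \<in> open_box (first_rect \<rho> \<theta> i (Some j))"
  shows "x \<in> frontier (voronoi_cell \<rho> \<theta> (0, 0)) \<longleftrightarrow> side (corner_point i j) x = 0"
proof -
  let ?V = "voronoi_cell \<rho> \<theta> (0, 0)" and ?p = "corner_point i j"
    and ?B = "open_box (first_rect \<rho> \<theta> i (Some j))"
  have p: "?p \<noteq> 0"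
    using ij h_pos by (auto simp: corner_point_def prod_eq_iff)
  have inside: "y \<in> ?V" if "y \<in> ?B" "side ?p y < 0" for y
    using corner_core(1)[OF ij that] core_subset_voronoi by blast
  have outside: "y \<notin> ?V" if "y \<in> ?B" "0 < side ?p y" for y
  proof
    assume "y \<in> ?V"
    then have "(0, 0) \<in> nearest \<rho> \<theta> y"
      by (simp add: nearest_def zero_in_lat)
    then show False
      using nearest_core[OF corner_point_in_lat corner_core(2)[OF ij that]] p by (simp add: zero_prod_def)
  qed
  show ?thesis
  proof
    assume fr: "x \<in> frontier ?V"
    then have "\<not> side ?p x < 0"
      using corner_core(1)[OF ij x] frontier_voronoi_core by blast
    moreover have "\<not> 0 < side ?p x"
    proof
      assume "0 < side ?p x"
      let ?O = "?B \<inter> {y. 0 < side ?p y}"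
      have "open ?O"
        by (intro open_Int open_open_box open_Collect_less continuous_intros)
      moreover have "?O \<inter> ?V = {}"
        using outside by auto
      ultimately have "?O \<inter> closure ?V = {}"
        by (simp add: open_Int_closure_eq_empty)
      then show False
        using fr x \<open>0 < side ?p x\<close> by (auto simp: frontier_def)
    qed
    ultimately show "side ?p x = 0"
      by simp
  next
    assume zero: "side ?p x = 0"
    show "x \<in> frontier ?V"
      unfolding frontier_straddle
    proof (intro allI impI)
      fix e :: real assume "0 < e"
      obtain d where d: "0 < d" "ball x d \<subseteq> ?B"
        using open_contains_ball open_open_box x by blast
      \<comment> \<open>Makes the step length \<open>s * norm ?p\<close> half of the smaller radius:
        the moved points stay in the box and within distance \<open>e\<close>.\<close>
      define s where "s = min d e / (2 * norm ?p)"
      have s: "0 < s" "s * norm ?p < d" "s * norm ?p < e"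
        using p d \<open>0 < e\<close> by (auto simp: s_def min_def)
      have pp: "0 < inner ?p ?p"
        using p by simp
      have dist: "dist x (x + t *\<^sub>R ?p) = \<bar>t\<bar> * norm ?p" for t
        by (simp add: dist_norm)
      have side: "side ?p (x + t *\<^sub>R ?p) = t * inner ?p ?p" for t
        using zero by (simp add: inner_add_right)
      have near: "x + t *\<^sub>R ?p \<in> ?B" if "\<bar>t\<bar> = s" for t
        using d(2) s(2) dist[of t] that by (intro subsetD[OF d(2)]) (simp only: mem_ball)
      have "x + (- s) *\<^sub>R ?p \<in> ?V"
        using s(1) pp by (intro inside near) (simp_all only: side, auto)
      moreover have "x + s *\<^sub>R ?p \<notin> ?V"
        using s(1) pp by (intro outside near) (simp_all only: side, auto)
      ultimately show "(\<exists>y\<in>?V. dist x y < e) \<and> (\<exists>y. y \<notin> ?V \<and> dist x y < e)"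
        using dist[of s] dist[of "- s"] s by (metis abs_minus_cancel abs_of_pos)
    qed
  qed
qed

text \<open>Scaling the bounds by \<open>c\<close>, \<open>1 - c\<close> and \<open>h\<close> makes
  all six hexagon inequalities linear. No bisector enters these rectangles, so they need no later
  round.\<close>

lemma central_core:
  assumes "i = 0 \<and> u = None \<or> i \<in> {-1, 1} \<and> u = Some 0"
    and "x \<in> open_box (first_rect \<rho> \<theta> i u)"
  shows "x \<in> core"
proof -
  obtain s t where st: "x = (s, t)"
    by force
  let ?r = "first_rect \<rho> \<theta> i u"
  have s: "fst (fst ?r) < s" "s < snd (fst ?r)" and t: "fst (snd ?r) < t" "t < snd (snd ?r)"
    using assms(2) by (auto simp: st open_box_def)
  note scaled = mult_strict_left_mono[OF s(1) c_bounds(1)] mult_strict_left_mono[OF s(2) c_bounds(1)]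
    mult_strict_left_mono[OF s(1), of "1 - c"] mult_strict_left_mono[OF s(2), of "1 - c"]
    mult_strict_left_mono[OF t(1) h_pos] mult_strict_left_mono[OF t(2) h_pos]
  define cs ht cc hh where "cs = c * s" and "ht = h * t" and "cc = c * c" and "hh = h * h"
  note defs = cs_def ht_def cc_def hh_def
  have tau: "h * tau1 \<rho> \<theta> = (hh - c + cc) / 2"
    using h_tau1 by (simp add: defs power2_eq_square algebra_simps)
  have c: "cc < c / 2" "0 < cc" "c - cc < hh" "1 - cc \<le> hh"
    using c_bounds c_h_obtuse c_h_norm by (simp_all add: defs power2_eq_square algebra_simps)
  consider "i = 0" "u = None" | "i = 1" "u = Some 0" | "i = -1" "u = Some 0"
    using assms(1) by auto
  then show ?thesis
  proof cases
    case 1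
    then have "- 1 / 2 < s" "s < 1 / 2" "- c < 2 * cs" "2 * cs < c"
      "c - 1 < 2 * (cs - s)" "2 * (cs - s) < 1 - c"
      using s scaled(1-4) c_bounds by (auto simp: rect_defs defs field_simps)
    moreover have "- (hh - c + cc) < 2 * ht" "2 * ht < hh - c + cc"
      using 1 scaled(5,6) by (auto simp: rect_defs tau ht_def[symmetric] hh_def neg_half_less_iff)
    ultimately show ?thesis
      unfolding st using c c_bounds by (intro coreI[OF defs]; (linarith | simp))
  next
    case 2
    then have "c - 1 < 2 * s" "2 * s < c" "cc - c < 2 * cs" "2 * cs < cc"
      "cc - c < 2 * (cs - s)" "2 * (cs - s) < 1 - 2 * c + cc"
      using s scaled(1-4) c_bounds by (auto simp: rect_defs defs field_simps)
    moreover have "hh - c + cc < 2 * ht" "2 * ht < hh"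
      using 2 scaled(5,6) by (auto simp: rect_defs tau ht_def[symmetric] hh_def neg_half_less_iff)
    ultimately show ?thesis
      unfolding st using c c_bounds by (intro coreI[OF defs]; (linarith | simp))
  next
    case 3
    then have "- c < 2 * s" "2 * s < 1 - c" "- cc < 2 * cs" "2 * cs < c - cc"
      "- (1 - 2 * c + cc) < 2 * (cs - s)" "2 * (cs - s) < c - cc"
      using s scaled(1-4) c_bounds by (auto simp: rect_defs defs field_simps)
    moreover have "- hh < 2 * ht" "2 * ht < - (hh - c + cc)"
      using 3 scaled(5,6) by (auto simp: rect_defs tau ht_def[symmetric] hh_def neg_half_less_iff)
    ultimately show ?thesis
      unfolding st using c c_bounds by (intro coreI[OF defs]; (linarith | simp))
  qed
qed

text \<open>The thresholds are where bisectors leave the Babai cell: those of \<open>(c, h)\<close>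
  and \<open>(c - 1, h)\<close> meet the top side at \<open>t_1\<close> and \<open>t_m2\<close>, and
  the vertical sides \<open>x = 1/2\<close> and \<open>x = -1/2\<close> at height
  \<open>tau1\<close>. The lower row is the reflection.\<close>

lemma corner_diagonal:
  assumes "i \<in> {-1, 1}" "j \<in> {-1, 1}"
  shows "diagonal (j = -1) (corner_point i j) (first_rect \<rho> \<theta> i (Some j))"
  using assms c_bounds h_pos tau1_bounds h_tau1
  by (auto simp: diagonal_def nondegenerate_def rect_defs corner_point_def prod_eq_iff field_simps power2_eq_square)

end

section \<open>Transcripts\<close>

lemma current_rect_next_round:
  "current_rect \<rho> \<theta> (next_round \<rho> \<theta> x tr) = refine x (current_rect \<rho> \<theta> tr)"
  by (cases x; cases tr) (simp add: Let_def refine_def quad_def split_beta)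

definition first_round :: "real \<Rightarrow> real \<Rightarrow> real \<times> real \<Rightarrow> int \<times> int option" where
  "first_round \<rho> \<theta> x = (U2 \<rho> \<theta> (snd x), U1 \<rho> \<theta> (fst x) (U2 \<rho> \<theta> (snd x)))"

lemma transcript_after_form:
  "\<exists>bs. transcript_after \<rho> \<theta> x k = (fst (first_round \<rho> \<theta> x), snd (first_round \<rho> \<theta> x), bs) \<and> length bs = k"
proof (induction k)
  case (Suc k)
  then show ?case
    by (cases x) (auto simp: Let_def)
qed (simp add: first_round_def)

text \<open>Separates Round 1, which fixes the starting rectangle, from the purely geometric
  iteration of \<open>refine\<close>.\<close>

lemma current_rect_transcript_after:
  "current_rect \<rho> \<theta> (transcript_after \<rho> \<theta> x k)
    = (refine x ^^ k) (first_rect \<rho> \<theta> (fst (first_round \<rho> \<theta> x)) (snd (first_round \<rho> \<theta> x)))"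
  by (induction k) (simp_all add: first_round_def current_rect_next_round)

definition undecided :: "real \<Rightarrow> real \<Rightarrow> nat \<Rightarrow> real \<times> real \<Rightarrow> bool" where
  "undecided \<rho> \<theta> k x \<longleftrightarrow> \<not> error_free \<rho> \<theta> (current_rect \<rho> \<theta> (transcript_after \<rho> \<theta> x k))"

text \<open>Round 1 is excluded, so the value is 0 if the first rectangle is error-free. It is
  unspecified where the protocol never halts, which is shown to be a null event.\<close>

definition later_rounds :: "real \<Rightarrow> real \<Rightarrow> real \<times> real \<Rightarrow> nat" where
  "later_rounds \<rho> \<theta> x = (LEAST k. \<not> undecided \<rho> \<theta> k x)"

lemma final_transcript_eq: "final_transcript \<rho> \<theta> x = transcript_after \<rho> \<theta> x (later_rounds \<rho> \<theta> x)"
  by (simp add: final_transcript_def later_rounds_def undecided_def)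

lemma halts_iff: "halts \<rho> \<theta> x \<longleftrightarrow> (\<exists>k. \<not> undecided \<rho> \<theta> k x)"
  by (simp add: halts_def undecided_def)

lemma N_eq: "N \<rho> \<theta> x = 1 + later_rounds \<rho> \<theta> x"
  using transcript_after_form[of \<rho> \<theta> x "later_rounds \<rho> \<theta> x"]
  by (auto simp: N_def final_transcript_eq)

definition first_cost :: "real \<Rightarrow> real \<Rightarrow> int \<times> int option \<Rightarrow> real" where
  "first_cost \<rho> \<theta> v = bit_cost \<rho> \<theta> (fst v, snd v, [])"

lemma R_eq: "R \<rho> \<theta> x = first_cost \<rho> \<theta> (first_round \<rho> \<theta> x) + 2 * real (later_rounds \<rho> \<theta> x)"
  using transcript_after_form[of \<rho> \<theta> x "later_rounds \<rho> \<theta> x"]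
  by (auto simp: R_def final_transcript_eq first_cost_def)

section \<open>Measurability of messages and halting time\<close>

lemma measurable_fst_snd_borel:
  "fst \<in> borel \<rightarrow>\<^sub>M (borel :: real measure)" "snd \<in> borel \<rightarrow>\<^sub>M (borel :: real measure)"
  by (intro borel_measurable_continuous_onI continuous_intros)+

text \<open>The index depends on \<open>x\<close> only through three membership bits, and every
  function on a discrete space is measurable. Unspecified values of \<open>THE\<close> therefore do
  no harm.\<close>

lemma measurable_index_of:
  assumes "\<And>i. K i \<in> sets borel"
  shows "index_of K \<in> borel \<rightarrow>\<^sub>M count_space UNIV"
proof -
  define F where "F = (\<lambda>(b1, b2, b3). THE i :: int. i = -1 \<and> b1 \<or> i = 0 \<and> b2 \<or> i = 1 \<and> b3)"
  have "index_of K = (\<lambda>x. F (x \<in> K (-1), x \<in> K 0, x \<in> K 1))"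
    unfolding index_of_def F_def by (auto intro!: ext arg_cong[where f = The])
  moreover have "Measurable.pred borel (\<lambda>x. x \<in> K i)" for i
    using assms by simp
  then have "(\<lambda>x. (x \<in> K (-1), x \<in> K 0, x \<in> K 1)) \<in> borel \<rightarrow>\<^sub>M count_space UNIV"
    by measurable
  then have "(\<lambda>x. F (x \<in> K (-1), x \<in> K 0, x \<in> K 1)) \<in> borel \<rightarrow>\<^sub>M count_space UNIV"
    by (rule measurable_compose) simp
  ultimately show ?thesis
    by simp
qed

lemma measurable_U2 [measurable]: "U2 \<rho> \<theta> \<in> borel \<rightarrow>\<^sub>M count_space UNIV"
proof -
  have "U2 \<rho> \<theta> = index_of (\<lambda>i. half_open (J_ivl \<rho> \<theta> i))"
    by (auto simp: U2_def)
  then show ?thesis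
    by (simp add: measurable_index_of half_open_def)
qed

lemma measurable_U1 [measurable]: "(\<lambda>x1. U1 \<rho> \<theta> x1 u) \<in> borel \<rightarrow>\<^sub>M count_space UNIV"
proof -
  have "index_of (\<lambda>j. half_open (I_ivl \<rho> \<theta> j)) \<in> borel \<rightarrow>\<^sub>M count_space UNIV"
    by (simp add: measurable_index_of half_open_def)
  moreover have "index_of (\<lambda>j. uminus ` half_open (I_ivl \<rho> \<theta> j)) \<in> borel \<rightarrow>\<^sub>M count_space UNIV"
    by (simp add: measurable_index_of half_open_def image_uminus_greaterThanAtMost)
  ultimately show ?thesis
    unfolding U1_def by (cases "u = 1"; cases "u = -1") (auto intro: measurable_compose[where g = Some])
qed

text \<open>Transcripts form a countable type, so it suffices that each round is measurable with the
  previous messages held fixed.\<close>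

lemma measurable_transcript_after [measurable]:
  "(\<lambda>x. transcript_after \<rho> \<theta> x k) \<in> borel \<rightarrow>\<^sub>M count_space UNIV"
proof (induction k)
  case 0
  have 1: "(\<lambda>x :: real \<times> real. U2 \<rho> \<theta> (snd x)) \<in> borel \<rightarrow>\<^sub>M count_space UNIV"
    by (rule measurable_compose[OF measurable_fst_snd_borel(2) measurable_U2])
  have 2: "(\<lambda>x :: real \<times> real. (u, U1 \<rho> \<theta> (fst x) u, [] :: (bool \<times> bool) list)) \<in> borel \<rightarrow>\<^sub>M count_space UNIV" for u
    by (rule measurable_compose[OF measurable_compose[OF measurable_fst_snd_borel(1) measurable_U1]]) simp
  show ?case
    using measurable_compose_countable[OF 2 1] by simp
next
  case (Suc k)
  have "(\<lambda>x. next_round \<rho> \<theta> x tr) \<in> borel \<rightarrow>\<^sub>M count_space UNIV" for tr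
  proof -
    obtain u2 u1 bs where tr: "tr = (u2, u1, bs)"
      by (cases tr)
    let ?r = "current_rect \<rho> \<theta> tr"
    have b: "Measurable.pred borel (\<lambda>x :: real \<times> real. half_bit (snd x) (snd ?r))"
      "Measurable.pred borel (\<lambda>x :: real \<times> real. half_bit (fst x) (fst ?r))"
      unfolding half_bit_def using measurable_fst_snd_borel by measurable
    have "(\<lambda>x. (half_bit (snd x) (snd ?r), half_bit (fst x) (fst ?r))) \<in> borel \<rightarrow>\<^sub>M count_space UNIV"
      using b by measurable
    then have "(\<lambda>x. (u2, u1, bs @ [(half_bit (snd x) (snd ?r), half_bit (fst x) (fst ?r))])) \<in> borel \<rightarrow>\<^sub>M count_space UNIV"
      by (rule measurable_compose) simp
    moreover have "next_round \<rho> \<theta> x tr = (u2, u1, bs @ [(half_bit (snd x) (snd ?r), half_bit (fst x) (fst ?r))])" for x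
      by (cases x) (simp add: tr Let_def)
    ultimately show ?thesis
      by simp
  qed
  from measurable_compose_countable[OF this Suc] show ?case
    by simp
qed

lemma measurable_first_round [measurable]: "first_round \<rho> \<theta> \<in> borel \<rightarrow>\<^sub>M count_space UNIV"
proof -
  have "first_round \<rho> \<theta> = (\<lambda>x. (\<lambda>(u2, u1, bs). (u2, u1)) (transcript_after \<rho> \<theta> x 0))"
    by (auto simp: first_round_def)
  also have "\<dots> \<in> borel \<rightarrow>\<^sub>M count_space UNIV"
    by (rule measurable_compose[OF measurable_transcript_after]) simp
  finally show ?thesis .
qed

lemma measurable_undecided [measurable]: "Measurable.pred borel (undecided \<rho> \<theta> k)"
proof -
  have "undecided \<rho> \<theta> k = (\<lambda>x. (\<lambda>tr. \<not> error_free \<rho> \<theta> (current_rect \<rho> \<theta> tr)) (transcript_after \<rho> \<theta> x k))"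
    by (auto simp: undecided_def)
  also have "\<dots> \<in> borel \<rightarrow>\<^sub>M count_space UNIV"
    by (rule measurable_compose[OF measurable_transcript_after]) simp
  finally show ?thesis .
qed

lemma measurable_later_rounds [measurable]: "later_rounds \<rho> \<theta> \<in> borel \<rightarrow>\<^sub>M count_space UNIV"
  unfolding later_rounds_def by measurable

text \<open>Avoiding all dyadic endpoints at once, a null set, removes the boundary cases of the half-open
  intervals and of the reflected ones.\<close>

definition generic :: "real \<Rightarrow> real \<Rightarrow> real \<times> real \<Rightarrow> bool" where
  "generic \<rho> \<theta> x \<longleftrightarrow> (\<forall>tr. let r = current_rect \<rho> \<theta> tr in
     fst x \<notin> {fst (fst r), snd (fst r)} \<and> snd x \<notin> {fst (snd r), snd (snd r)})"

lemma generic_open_box: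
  "generic \<rho> \<theta> x \<Longrightarrow> x \<in> half_open_box (current_rect \<rho> \<theta> tr) \<Longrightarrow> x \<in> open_box (current_rect \<rho> \<theta> tr)"
  unfolding generic_def half_open_box_def half_open_def open_box_def Let_def mem_Times_iff
    insert_iff empty_iff greaterThanAtMost_iff greaterThanLessThan_iff
  by (metis less_le)

lemma AE_lborel_coordinate_neq:
  fixes a :: real
  shows "AE x :: real \<times> real in lborel. fst x \<noteq> a"
    and "AE x :: real \<times> real in lborel. snd x \<noteq> a"
proof -
  have "emeasure lborel ({a} \<times> (UNIV :: real set)) = 0" "emeasure lborel ((UNIV :: real set) \<times> {a}) = 0"
    unfolding lborel_prod[symmetric] by (subst lborel.emeasure_pair_measure_Times; simp)+
  then have "{a} \<times> (UNIV :: real set) \<in> null_sets lborel" "(UNIV :: real set) \<times> {a} \<in> null_sets lborel"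
    by (auto simp: null_sets_def borel_closed closed_Times)
  from AE_not_in[OF this(1)] AE_not_in[OF this(2)]
  show "AE x :: real \<times> real in lborel. fst x \<noteq> a" "AE x :: real \<times> real in lborel. snd x \<noteq> a"
    by (auto elim!: eventually_mono simp: mem_Times_iff)
qed

text \<open>There are countably many transcripts, hence countably many lines to avoid, each of
  measure zero.\<close>

lemma AE_generic: "AE x in lborel. generic \<rho> \<theta> x"
  unfolding generic_def Let_def AE_all_countable insert_iff empty_iff de_Morgan_disj
  using AE_lborel_coordinate_neq by simp

section \<open>The uniform law on the Babai cell\<close>

context babai
begin

abbreviation M :: "(real \<times> real) measure" where "M \<equiv> babai_law \<rho> \<theta>"

sublocale M: prob_space M
  using h_pos by (intro prob_space_babai_law) (simp add: h_def)

lemma sets_M [measurable_cong, simp]: "sets M = sets borel"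
  by (simp add: babai_law_def)

lemma space_M [simp]: "space M = UNIV"
  by (simp add: babai_law_def space_uniform_measure)

lemma babai_cell_eq: "babai_cell \<rho> \<theta> = half_open_box ((-1/2, 1/2), (- h / 2, h / 2))"
  by (simp add: babai_cell_def half_open_box_def half_open_def h_def)

lemma emeasure_babai_cell: "emeasure lborel (babai_cell \<rho> \<theta>) = ennreal h"
  unfolding babai_cell_eq using h_pos
  by (subst emeasure_half_open_box) (auto simp: nondegenerate_def area_def)

lemma AE_M_iff: "(AE x in M. p x) \<longleftrightarrow> (AE x in lborel. x \<in> babai_cell \<rho> \<theta> \<longrightarrow> p x)"
  unfolding babai_law_def using h_pos
  by (intro AE_uniform_measure) (auto simp: emeasure_babai_cell)

lemma AE_M_generic: "AE x in M. generic \<rho> \<theta> x \<and> x \<in> babai_cell \<rho> \<theta>"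
  unfolding AE_M_iff by (rule eventually_mono[OF AE_generic[of \<rho> \<theta>]]) simp

lemma prob_subset_cell:
  assumes "A \<in> sets borel" "A \<subseteq> babai_cell \<rho> \<theta>" "emeasure lborel A = ennreal a" "0 \<le> a"
  shows "M.prob A = a / h"
proof -
  have "M.prob A = measure lborel (babai_cell \<rho> \<theta> \<inter> A) / measure lborel (babai_cell \<rho> \<theta>)"
    unfolding babai_law_def using assms h_pos
    by (intro measure_uniform_measure) (auto simp: emeasure_babai_cell)
  also have "babai_cell \<rho> \<theta> \<inter> A = A"
    using assms by auto
  finally show ?thesis
    using assms h_pos by (simp add: measure_def emeasure_babai_cell)
qed

end

section \<open>The outcome of Round 1 and decoding\<close>

lemma index_of_eqI:
  assumes "i \<in> {-1, 0, 1}" "x \<in> K i" "\<And>j. j \<in> {-1, 0, 1} \<Longrightarrow> x \<in> K j \<Longrightarrow> j = i"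
  shows "index_of K x = i"
  unfolding index_of_def using assms by (intro the_equality) blast+

context babai
begin

text \<open>The seven results of Round 1 that occur outside a null set.\<close>

definition outcomes :: "(int \<times> int option) set" where
  "outcomes = {(0, None)} \<union> {-1, 1} \<times> {Some (-1), Some 0, Some 1}"

abbreviation outcome_rect :: "int \<times> int option \<Rightarrow> rect" where
  "outcome_rect v \<equiv> first_rect \<rho> \<theta> (fst v) (snd v)"

lemma nondegenerate_outcome: "v \<in> outcomes \<Longrightarrow> nondegenerate (outcome_rect v)"
  using c_bounds tau1_bounds by (auto simp: outcomes_def nondegenerate_def rect_defs)

lemma outcome_rect_subset: "v \<in> outcomes \<Longrightarrow> half_open_box (outcome_rect v) \<subseteq> babai_cell \<rho> \<theta>"
  using c_bounds tau1_bounds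
  by (auto simp: babai_cell_eq outcomes_def rect_defs half_open_box_def half_open_def field_simps)

lemma U2_iff:
  assumes "- h / 2 < x" "x \<le> h / 2" "i \<in> {-1, 0, 1}"
  shows "U2 \<rho> \<theta> x = i \<longleftrightarrow> x \<in> half_open (J_ivl \<rho> \<theta> i)"
proof -
  have uniq: "j = k" if "x \<in> half_open (J_ivl \<rho> \<theta> j)" "x \<in> half_open (J_ivl \<rho> \<theta> k)"
    "j \<in> {-1, 0, 1}" "k \<in> {-1, 0, 1}" for j k
    using that tau1_bounds by (auto simp: half_open_def rect_defs)
  have eq: "U2 \<rho> \<theta> x = j" if "x \<in> half_open (J_ivl \<rho> \<theta> j)" "j \<in> {-1, 0, 1}" for j
    unfolding U2_def using that uniq by (intro index_of_eqI) blast+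
  have "x \<in> half_open (J_ivl \<rho> \<theta> (-1)) \<or> x \<in> half_open (J_ivl \<rho> \<theta> 0) \<or> x \<in> half_open (J_ivl \<rho> \<theta> 1)"
    using assms by (auto simp: half_open_def rect_defs)
  then obtain j where "x \<in> half_open (J_ivl \<rho> \<theta> j)" "j \<in> {-1, 0, 1}"
    by blast
  then show ?thesis
    using eq uniq assms(3) by metis
qed

lemma U1_pos_iff:
  assumes "- 1 / 2 < x" "x \<le> 1 / 2" "j \<in> {-1, 0, 1}"
  shows "U1 \<rho> \<theta> x 1 = Some j \<longleftrightarrow> x \<in> half_open (I_ivl \<rho> \<theta> j)"
    and "U1 \<rho> \<theta> x 1 \<in> {Some (-1), Some 0, Some 1}"
proof -
  have uniq: "j = k" if "x \<in> half_open (I_ivl \<rho> \<theta> j)" "x \<in> half_open (I_ivl \<rho> \<theta> k)"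
    "j \<in> {-1, 0, 1}" "k \<in> {-1, 0, 1}" for j k
    using that c_bounds by (auto simp: half_open_def rect_defs)
  have eq: "U1 \<rho> \<theta> x 1 = Some j" if "x \<in> half_open (I_ivl \<rho> \<theta> j)" "j \<in> {-1, 0, 1}" for j
    unfolding U1_def if_P[OF refl] option.inject using that uniq by (intro index_of_eqI) blast+
  have "x \<in> half_open (I_ivl \<rho> \<theta> (-1)) \<or> x \<in> half_open (I_ivl \<rho> \<theta> 0) \<or> x \<in> half_open (I_ivl \<rho> \<theta> 1)"
    using assms by (auto simp: half_open_def rect_defs)
  then obtain k where k: "x \<in> half_open (I_ivl \<rho> \<theta> k)" "k \<in> {-1, 0, 1}"
    by blast
  show "U1 \<rho> \<theta> x 1 = Some j \<longleftrightarrow> x \<in> half_open (I_ivl \<rho> \<theta> j)"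
    using k eq uniq assms(3) by (metis option.inject)
  show "U1 \<rho> \<theta> x 1 \<in> {Some (-1), Some 0, Some 1}"
    using eq[OF k] k(2) by auto
qed

text \<open>Reflected intervals are closed on the left, hence the range \<open>[-1/2, 1/2)\<close>
  instead of the one for \<open>U1_pos_iff\<close>.\<close>

lemma U1_neg_iff:
  assumes "- 1 / 2 \<le> x" "x < 1 / 2" "j \<in> {-1, 0, 1}"
  shows "U1 \<rho> \<theta> x (-1) = Some j \<longleftrightarrow> x \<in> uminus ` half_open (I_ivl \<rho> \<theta> j)"
    and "U1 \<rho> \<theta> x (-1) \<in> {Some (-1), Some 0, Some 1}"
proof -
  have uniq: "j = k" if "x \<in> uminus ` half_open (I_ivl \<rho> \<theta> j)" "x \<in> uminus ` half_open (I_ivl \<rho> \<theta> k)"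
    "j \<in> {-1, 0, 1}" "k \<in> {-1, 0, 1}" for j k
    using that c_bounds by (auto simp: half_open_def rect_defs field_simps)
  have U1: "U1 \<rho> \<theta> x (-1) = Some (index_of (\<lambda>j. uminus ` half_open (I_ivl \<rho> \<theta> j)) x)"
    by (simp add: U1_def)
  have eq: "U1 \<rho> \<theta> x (-1) = Some j" if "x \<in> uminus ` half_open (I_ivl \<rho> \<theta> j)" "j \<in> {-1, 0, 1}" for j
    unfolding U1 option.inject using that uniq by (intro index_of_eqI) blast+
  have "x \<in> uminus ` half_open (I_ivl \<rho> \<theta> (-1)) \<or> x \<in> uminus ` half_open (I_ivl \<rho> \<theta> 0)
      \<or> x \<in> uminus ` half_open (I_ivl \<rho> \<theta> 1)"
    using assms by (auto simp: half_open_def rect_defs image_uminus_greaterThanAtMost)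
  then obtain k where k: "x \<in> uminus ` half_open (I_ivl \<rho> \<theta> k)" "k \<in> {-1, 0, 1}"
    by blast
  show "U1 \<rho> \<theta> x (-1) = Some j \<longleftrightarrow> x \<in> uminus ` half_open (I_ivl \<rho> \<theta> j)"
    using k eq uniq assms(3) by (metis option.inject)
  show "U1 \<rho> \<theta> x (-1) \<in> {Some (-1), Some 0, Some 1}"
    using eq[OF k] k(2) by auto
qed

lemma generic_coordinates:
  assumes "generic \<rho> \<theta> x" "x \<in> babai_cell \<rho> \<theta>"
  shows "- 1 / 2 < fst x" "fst x < 1 / 2" "- h / 2 < snd x" "snd x \<le> h / 2"
    and "\<And>j. fst x \<noteq> - fst (I_ivl \<rho> \<theta> j)" "\<And>j. fst x \<noteq> - snd (I_ivl \<rho> \<theta> j)"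
proof -
  \<comment> \<open>The transcript \<open>(0, None, [])\<close> has the full horizontal side, whose
    right end is \<open>1/2\<close>; below, \<open>(-1, Some j, [])\<close> yields the reflected
    endpoints.\<close>
  have "fst x \<noteq> 1 / 2"
    using assms(1)[unfolded generic_def, rule_format, of "(0, None, [])"] by (simp add: first_rect_def)
  then show "- 1 / 2 < fst x" "fst x < 1 / 2" "- h / 2 < snd x" "snd x \<le> h / 2"
    using assms(2) by (auto simp: babai_cell_eq half_open_box_def half_open_def mem_Times_iff)
  show "fst x \<noteq> - fst (I_ivl \<rho> \<theta> j)" "fst x \<noteq> - snd (I_ivl \<rho> \<theta> j)" for j
    using assms(1)[unfolded generic_def, rule_format, of "(-1, Some j, [])"]
    by (simp_all add: first_rect_def reflect_def)
qed

lemma first_round_iff: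
  assumes "generic \<rho> \<theta> x" "x \<in> babai_cell \<rho> \<theta>" "v \<in> outcomes"
  shows "first_round \<rho> \<theta> x = v \<longleftrightarrow> x \<in> half_open_box (outcome_rect v)"
proof -
  note co = generic_coordinates[OF assms(1,2)]
  have U2: "U2 \<rho> \<theta> (snd x) = i \<longleftrightarrow> snd x \<in> half_open (J_ivl \<rho> \<theta> i)" if "i \<in> {-1, 0, 1}" for i
    using co that by (intro U2_iff)
  consider "v = (0, None)" | j where "v = (1, Some j)" "j \<in> {-1, 0, 1}"
    | j where "v = (-1, Some j)" "j \<in> {-1, 0, 1}"
    using assms(3) by (auto simp: outcomes_def)
  then show ?thesis
  proof cases
    case 1
    then show ?thesis
      using U2[of 0] co by (auto simp: first_round_def U1_def half_open_box_def first_rect_def half_open_def mem_Times_iff)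
  next
    case 2
    then show ?thesis
      using U2[of 1] U1_pos_iff(1)[of "fst x" j] co
      by (auto simp: first_round_def half_open_box_def first_rect_def mem_Times_iff)
  next
    case 3
    \<comment> \<open>The message uses an interval closed on the left, the rectangle one closed on
      the right; a generic point avoids both ends.\<close>
    have "fst x \<in> uminus ` half_open (I_ivl \<rho> \<theta> j) \<longleftrightarrow> fst x \<in> half_open (reflect (I_ivl \<rho> \<theta> j))"
      using co(5,6)[of j] by (auto simp: half_open_def reflect_def image_uminus_greaterThanAtMost)
    then show ?thesis
      using 3 U2[of "-1"] U1_neg_iff(1)[of "fst x" j] co
      by (auto simp: first_round_def half_open_box_def first_rect_def mem_Times_iff)
  qed
qed

lemma first_round_outcomes:
  assumes "generic \<rho> \<theta> x" "x \<in> babai_cell \<rho> \<theta>"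
  shows "first_round \<rho> \<theta> x \<in> outcomes"
proof -
  note co = generic_coordinates[OF assms(1,2)]
  have U2: "U2 \<rho> \<theta> (snd x) = i \<longleftrightarrow> snd x \<in> half_open (J_ivl \<rho> \<theta> i)" if "i \<in> {-1, 0, 1}" for i
    using co that by (intro U2_iff)
  have "snd x \<in> half_open (J_ivl \<rho> \<theta> (-1)) \<or> snd x \<in> half_open (J_ivl \<rho> \<theta> 0) \<or> snd x \<in> half_open (J_ivl \<rho> \<theta> 1)"
    using co by (auto simp: half_open_def rect_defs)
  then consider "U2 \<rho> \<theta> (snd x) = 0" | "U2 \<rho> \<theta> (snd x) = 1" | "U2 \<rho> \<theta> (snd x) = -1"
    using U2 by auto
  then show ?thesis
    using U1_pos_iff(2)[of "fst x" 0] U1_neg_iff(2)[of "fst x" 0] co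
    by cases (auto simp: outcomes_def first_round_def U1_def[of _ _ _ 0])
qed

text \<open>The invariant is kept for half-open boxes, which the bits partition exactly; genericity
  passes to the open box once, at the end.\<close>

lemma generic_mem_current_rect:
  assumes "generic \<rho> \<theta> x" "x \<in> babai_cell \<rho> \<theta>"
  shows "x \<in> open_box (current_rect \<rho> \<theta> (transcript_after \<rho> \<theta> x k))"
proof -
  let ?r = "outcome_rect (first_round \<rho> \<theta> x)"
  note out = first_round_outcomes[OF assms]
  have "x \<in> half_open_box ((refine x ^^ k) ?r)"
  proof (induction k)
    case 0
    then show ?case
      using first_round_iff[OF assms out] by simp
  next
    case (Suc k)
    then show ?case
      using mem_half_open_box_quad[OF nondegenerate_refine[OF nondegenerate_outcome[OF out], of k x], of x]
      by (simp add: refine_def[of x "(refine x ^^ k) ?r"])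
  qed
  then show ?thesis
    using generic_open_box[OF assms(1), of "transcript_after \<rho> \<theta> x k"]
    by (simp only: current_rect_transcript_after)
qed

section \<open>Decoding and the halting time\<close>

definition corners :: "(int \<times> int option) set" where
  "corners = {-1, 1} \<times> {Some (-1), Some 1}"

lemma outcomes_cases:
  assumes "v \<in> outcomes"
  obtains "v \<notin> corners" "open_box (outcome_rect v) \<subseteq> core"
  | i j where "v = (i, Some j)" "v \<in> corners" "i \<in> {-1, 1}" "j \<in> {-1, 1}"
proof (cases "v \<in> corners")
  case True
  then show ?thesis
    using that(2) by (auto simp: corners_def)
next
  case False
  then have "fst v = 0 \<and> snd v = None \<or> fst v \<in> {-1, 1} \<and> snd v = Some 0"
    using assms by (auto simp: corners_def outcomes_def)
  then show ?thesis
    using that(1) False central_core by blast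
qed

text \<open>An error-free box in a corner misses the bisector and is connected, so it lies on one
  side of it and the closest point is the same throughout.\<close>

lemma nearest_constant:
  assumes "v \<in> outcomes" "open_box r \<subseteq> open_box (outcome_rect v)" "error_free \<rho> \<theta> r"
  shows "\<exists>p. \<forall>y\<in>open_box r. nearest \<rho> \<theta> y = {p}"
  using assms(1)
proof (cases rule: outcomes_cases)
  case 1
  then have "\<forall>y\<in>open_box r. nearest \<rho> \<theta> y = {(0, 0)}"
    using assms(2) nearest_zero by blast
  then show ?thesis
    by blast
next
  case (2 i j)
  let ?p = "corner_point i j"
  have ne: "side ?p y \<noteq> 0" if "y \<in> open_box r" for y
  proof -
    have "y \<in> open_box (first_rect \<rho> \<theta> i (Some j))"
      using that assms(2) 2(1) by auto
    from corner_frontier[OF 2(3,4) this] show ?thesis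
      using that assms(3) unfolding error_free_iff by blast
  qed
  have inner_ne: "inner ?p y \<noteq> inner ?p ?p / 2" if "y \<in> open_box r" for y
    using ne[OF that] by simp
  show ?thesis
  proof (cases "\<exists>y\<in>open_box r. side ?p y < 0")
    case True
    have "side ?p y < 0" if y: "y \<in> open_box r" for y
    proof (rule ccontr)
      obtain z where z: "z \<in> open_box r" "inner ?p z \<le> inner ?p ?p / 2"
        using True by auto
      assume "\<not> side ?p y < 0"
      then have "inner ?p ?p / 2 \<le> inner ?p y"
        by simp
      \<comment> \<open>Points on both sides would force a point of the bisector in the box by the
        intermediate value theorem.\<close>
      with connected_ivt_hyperplane[OF convex_connected[OF convex_open_box] z(1) y z(2)] inner_ne
      show False
        by blast
    qed
    then have "\<forall>y\<in>open_box r. nearest \<rho> \<theta> y = {(0, 0)}"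
      using assms(2) 2(1) corner_core(1)[OF 2(3,4)] by (intro ballI nearest_zero) auto
    then show ?thesis
      by blast
  next
    case False
    then have "\<forall>y\<in>open_box r. nearest \<rho> \<theta> y = {?p}"
      using assms(2) 2 corner_core(2)[OF 2(3,4)] ne
      by (intro ballI nearest_core corner_point_in_lat) (metis fst_conv not_less_iff_gr_or_eq snd_conv subsetD)
    then show ?thesis
      by blast
  qed
qed

text \<open>A function of the transcript alone, so either node can evaluate it.\<close>

definition decode :: "transcript \<Rightarrow> real \<times> real" where
  "decode tr = (SOME p. \<forall>y\<in>open_box (current_rect \<rho> \<theta> tr). nearest \<rho> \<theta> y = {p})"

lemma nearest_decode:
  assumes "generic \<rho> \<theta> x" "x \<in> babai_cell \<rho> \<theta>" "halts \<rho> \<theta> x"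
  shows "nearest \<rho> \<theta> x = {decode (final_transcript \<rho> \<theta> x)}"
proof -
  let ?tr = "final_transcript \<rho> \<theta> x"
  note out = first_round_outcomes[OF assms(1,2)]
  have "\<not> undecided \<rho> \<theta> (later_rounds \<rho> \<theta> x) x"
    using assms(3) unfolding halts_iff later_rounds_def by (rule LeastI_ex)
  then have ef: "error_free \<rho> \<theta> (current_rect \<rho> \<theta> ?tr)"
    by (simp add: undecided_def final_transcript_eq)
  have "open_box (current_rect \<rho> \<theta> ?tr) \<subseteq> open_box (outcome_rect (first_round \<rho> \<theta> x))"
    unfolding final_transcript_eq current_rect_transcript_after
    by (rule open_box_refine_subset[OF nondegenerate_outcome[OF out]])
  from nearest_constant[OF out this ef]
  have "\<forall>y\<in>open_box (current_rect \<rho> \<theta> ?tr). nearest \<rho> \<theta> y = {decode ?tr}"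
    unfolding decode_def by (rule someI_ex)
  then show ?thesis
    using generic_mem_current_rect[OF assms(1,2)] by (simp add: final_transcript_eq)
qed

text \<open>Once decided, a rectangle stays decided by \<open>error_free_refine\<close>. This turns
  the tail events of the halting time into the events whose probability is known from areas.\<close>

lemma undecided_less_iff:
  assumes "generic \<rho> \<theta> x" "x \<in> babai_cell \<rho> \<theta>" "halts \<rho> \<theta> x"
  shows "k < later_rounds \<rho> \<theta> x \<longleftrightarrow> undecided \<rho> \<theta> k x"
proof
  assume "k < later_rounds \<rho> \<theta> x"
  then show "undecided \<rho> \<theta> k x"
    unfolding later_rounds_def using not_less_Least by blast
next
  assume und: "undecided \<rho> \<theta> k x"
  let ?n = "later_rounds \<rho> \<theta> x" and ?r = "outcome_rect (first_round \<rho> \<theta> x)"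
  note nd = nondegenerate_outcome[OF first_round_outcomes[OF assms(1,2)]]
  have n: "\<not> undecided \<rho> \<theta> ?n x"
    using assms(3) unfolding halts_iff later_rounds_def by (rule LeastI_ex)
  show "k < ?n"
  proof (rule ccontr)
    assume "\<not> k < ?n"
    then have "(refine x ^^ k) ?r = (refine x ^^ (k - ?n)) ((refine x ^^ ?n) ?r)"
      using funpow_add[of "k - ?n" ?n "refine x"] by simp
    then show False
      using und n error_free_refine[OF nondegenerate_refine[OF nd], of \<rho> \<theta> ?n x "k - ?n" x]
      by (simp add: undecided_def current_rect_transcript_after)
  qed
qed

section \<open>Probabilities and expectations\<close>

lemma first_round_event [measurable]: "{x. first_round \<rho> \<theta> x = v} \<in> sets borel"
  using measurable_sets[OF measurable_first_round[of \<rho> \<theta>], of "{v}"] by (simp add: vimage_def)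

lemma undecided_event [measurable]: "{x. undecided \<rho> \<theta> k x} \<in> sets borel"
  using measurable_undecided[of \<rho> \<theta> k] by (simp add: pred_def)

lemma prob_AE_half_open_box:
  assumes "{x. p x} \<in> sets borel" "half_open_box r \<subseteq> babai_cell \<rho> \<theta>" "nondegenerate r"
    and "\<And>x. generic \<rho> \<theta> x \<Longrightarrow> x \<in> babai_cell \<rho> \<theta> \<Longrightarrow> p x \<longleftrightarrow> x \<in> half_open_box r"
  shows "M.prob {x. p x} = area r / h"
proof -
  have "AE x in M. x \<in> {x. p x} \<longleftrightarrow> x \<in> half_open_box r"
    using AE_M_generic by (rule eventually_mono) (simp add: assms(4))
  then have "M.prob {x. p x} = M.prob (half_open_box r)"
    using assms(1) by (intro M.finite_measure_eq_AE) auto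
  also have "\<dots> = area r / h"
    using assms(2,3) by (intro prob_subset_cell emeasure_half_open_box) (auto simp: nondegenerate_def area_def)
  finally show ?thesis .
qed

lemma prob_first_round: "v \<in> outcomes \<Longrightarrow> M.prob {x. first_round \<rho> \<theta> x = v} = area (outcome_rect v) / h"
  by (intro prob_AE_half_open_box first_round_event outcome_rect_subset nondegenerate_outcome first_round_iff)

lemma Q_eq:
  assumes "i \<in> {-1, 0, 1}"
  shows "Q \<rho> \<theta> i = (snd (J_ivl \<rho> \<theta> i) - fst (J_ivl \<rho> \<theta> i)) / h"
proof -
  let ?r = "((- 1 / 2, 1 / 2), J_ivl \<rho> \<theta> i)"
  have meas: "{x. U2 \<rho> \<theta> (snd x) = i} \<in> sets borel"
    using measurable_sets[OF measurable_compose[OF measurable_fst_snd_borel(2) measurable_U2[of \<rho> \<theta>]], of "{i}"]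
    by (simp add: vimage_def)
  have "M.prob {x. U2 \<rho> \<theta> (snd x) = i} = area ?r / h"
  proof (intro prob_AE_half_open_box meas)
    show "half_open_box ?r \<subseteq> babai_cell \<rho> \<theta>" "nondegenerate ?r"
      using assms tau1_bounds
      by (auto simp: babai_cell_eq half_open_box_def half_open_def nondegenerate_def J_ivl_def cell_height_eq)
    fix x assume x: "generic \<rho> \<theta> x" "x \<in> babai_cell \<rho> \<theta>"
    show "U2 \<rho> \<theta> (snd x) = i \<longleftrightarrow> x \<in> half_open_box ?r"
      using U2_iff[OF generic_coordinates(3,4)[OF x] assms] generic_coordinates(1,2)[OF x]
      by (auto simp: half_open_box_def mem_Times_iff half_open_def)
  qed
  then show ?thesis
    by (simp add: Q_def area_def)
qed

lemma Q_values:
  "Q \<rho> \<theta> 1 = (h / 2 - tau1 \<rho> \<theta>) / h" "Q \<rho> \<theta> (-1) = (h / 2 - tau1 \<rho> \<theta>) / h" "Q \<rho> \<theta> 0 = 2 * tau1 \<rho> \<theta> / h"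
  by (simp_all add: Q_eq J_ivl_def cell_height_eq)

lemma P_eq:
  assumes "j \<in> {-1, 0, 1}"
  shows "P \<rho> \<theta> j = snd (I_ivl \<rho> \<theta> j) - fst (I_ivl \<rho> \<theta> j)"
proof -
  have "M.prob {x. U1 \<rho> \<theta> (fst x) (U2 \<rho> \<theta> (snd x)) = Some j \<and> U2 \<rho> \<theta> (snd x) = 1}
      = M.prob {x. first_round \<rho> \<theta> x = (1, Some j)}"
    by (intro arg_cong[where f = M.prob]) (auto simp: first_round_def)
  also have "\<dots> = area (outcome_rect (1, Some j)) / h"
    using assms by (intro prob_first_round) (auto simp: outcomes_def)
  also have "\<dots> = (snd (I_ivl \<rho> \<theta> j) - fst (I_ivl \<rho> \<theta> j)) * Q \<rho> \<theta> 1"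
    by (simp add: area_def first_rect_def Q_eq)
  finally have "M.prob {x. U1 \<rho> \<theta> (fst x) (U2 \<rho> \<theta> (snd x)) = Some j \<and> U2 \<rho> \<theta> (snd x) = 1}
      = (snd (I_ivl \<rho> \<theta> j) - fst (I_ivl \<rho> \<theta> j)) * M.prob {x. U2 \<rho> \<theta> (snd x) = 1}"
    by (simp add: Q_def)
  moreover have "M.prob {x. U2 \<rho> \<theta> (snd x) = 1} \<noteq> 0"
    using Q_values(1) tau1_bounds h_pos by (simp add: Q_def)
  ultimately show ?thesis
    by (simp add: P_def cond_prob_def)
qed

lemma P_values: "P \<rho> \<theta> (-1) = c / 2" "P \<rho> \<theta> 0 = 1 / 2" "P \<rho> \<theta> 1 = (1 - c) / 2"
  by (simp_all add: P_eq I_ivl_def t_eq field_simps)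

lemma prob_central: "M.prob {x. first_round \<rho> \<theta> x = (0, None)} = Q \<rho> \<theta> 0"
  by (simp add: prob_first_round outcomes_def area_def first_rect_def Q_eq)

text \<open>\<open>P\<close> is conditioned on \<open>U2 = 1\<close>, but reflection preserves
  lengths, so the same reply probabilities hold in the lower row.\<close>

lemma prob_reply:
  assumes "i \<in> {-1, 1}" "j \<in> {-1, 0, 1}"
  shows "M.prob {x. first_round \<rho> \<theta> x = (i, Some j)} = Q \<rho> \<theta> i * P \<rho> \<theta> j"
proof -
  have "M.prob {x. first_round \<rho> \<theta> x = (i, Some j)} = area (outcome_rect (i, Some j)) / h"
    using assms by (intro prob_first_round) (auto simp: outcomes_def)
  also have "\<dots> = Q \<rho> \<theta> i * P \<rho> \<theta> j"
    using assms by (auto simp: area_def first_rect_def reflect_def Q_eq P_eq)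
  finally show ?thesis .
qed

section \<open>Halting probability and expected number of later rounds\<close>

lemma prob_undecided_corner:
  assumes "v \<in> corners"
  shows "M.prob {x. first_round \<rho> \<theta> x = v \<and> undecided \<rho> \<theta> k x} = M.prob {x. first_round \<rho> \<theta> x = v} / 2 ^ k"
proof -
  obtain i j where v: "v = (i, Some j)" and ij: "i \<in> {-1, 1}" "j \<in> {-1, 1}"
    using assms by (auto simp: corners_def)
  have out: "v \<in> outcomes"
    using assms by (auto simp: corners_def outcomes_def)
  let ?r = "outcome_rect v"
  let ?U = "{x \<in> half_open_box ?r. \<not> error_free \<rho> \<theta> ((refine x ^^ k) ?r)}"
  have U: "?U \<in> sets borel" "emeasure lborel ?U = ennreal (area ?r / 2 ^ k)"
    using emeasure_undecided[OF corner_diagonal[OF ij] corner_frontier[OF ij], of k] by (simp_all add: v)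
  have "AE x in M. x \<in> {x. first_round \<rho> \<theta> x = v \<and> undecided \<rho> \<theta> k x} \<longleftrightarrow> x \<in> ?U"
    using AE_M_generic
    by (rule eventually_mono) (auto simp: first_round_iff[OF _ _ out, symmetric] undecided_def current_rect_transcript_after)
  then have "M.prob {x. first_round \<rho> \<theta> x = v \<and> undecided \<rho> \<theta> k x} = M.prob ?U"
    using U(1) sets.Int[OF first_round_event[of v] undecided_event[of k]]
    by (intro M.finite_measure_eq_AE) (simp_all add: Int_def)
  also have "\<dots> = area ?r / 2 ^ k / h"
    using U outcome_rect_subset[OF out] nondegenerate_outcome[OF out]
    by (intro prob_subset_cell) (auto simp: nondegenerate_def area_def)
  finally show ?thesis
    by (simp add: prob_first_round[OF out])
qed

lemma undecided_corner:
  assumes "generic \<rho> \<theta> x" "x \<in> babai_cell \<rho> \<theta>" "undecided \<rho> \<theta> k x"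
  shows "first_round \<rho> \<theta> x \<in> corners"
proof (rule ccontr)
  let ?v = "first_round \<rho> \<theta> x"
  note out = first_round_outcomes[OF assms(1,2)]
  assume "?v \<notin> corners"
  then have "open_box (outcome_rect ?v) \<subseteq> core"
    by - (rule outcomes_cases[OF out], auto)
  then have "error_free \<rho> \<theta> (outcome_rect ?v)"
    using frontier_voronoi_core by (auto simp: error_free_iff)
  then show False
    using assms(3) error_free_refine[OF nondegenerate_outcome[OF out]]
    by (simp add: undecided_def current_rect_transcript_after)
qed

lemma P_Q_sums: "P \<rho> \<theta> (-1) + P \<rho> \<theta> 0 + P \<rho> \<theta> 1 = 1" "Q \<rho> \<theta> (-1) + Q \<rho> \<theta> 0 + Q \<rho> \<theta> 1 = 1"
  using h_pos by (simp_all add: P_values Q_values field_simps)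

text \<open>Only the four corners contribute, each halving per round; their total initial
  probability factors into a sum over replies and a sum over rows.\<close>

lemma prob_undecided: "M.prob {x. undecided \<rho> \<theta> k x} = (1 - P \<rho> \<theta> 0) * (1 - Q \<rho> \<theta> 0) / 2 ^ k"
proof -
  let ?E = "\<lambda>v. {x. first_round \<rho> \<theta> x = v \<and> undecided \<rho> \<theta> k x}"
  have meas: "?E v \<in> sets M" for v
    using sets.Int[OF first_round_event[of v] undecided_event[of k]] by (simp add: Int_def)
  have "AE x in M. x \<in> {x. undecided \<rho> \<theta> k x} \<longleftrightarrow> x \<in> (\<Union>v\<in>corners. ?E v)"
    using AE_M_generic by (rule eventually_mono) (auto dest: undecided_corner)
  then have "M.prob {x. undecided \<rho> \<theta> k x} = M.prob (\<Union>v\<in>corners. ?E v)"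
    using meas by (intro M.finite_measure_eq_AE) (auto simp: corners_def)
  also have "\<dots> = (\<Sum>v\<in>corners. M.prob (?E v))"
    using meas by (intro M.finite_measure_finite_Union) (auto simp: corners_def disjoint_family_on_def)
  also have "\<dots> = (\<Sum>v\<in>corners. M.prob {x. first_round \<rho> \<theta> x = v} / 2 ^ k)"
    by (intro sum.cong refl prob_undecided_corner)
  also have "\<dots> = (\<Sum>i\<in>{-1, 1}. \<Sum>u\<in>{Some (-1), Some 1}. M.prob {x. first_round \<rho> \<theta> x = (i, u)}) / 2 ^ k"
    by (simp add: corners_def sum.cartesian_product sum_divide_distrib[symmetric] case_prod_unfold
      del: sum.insert)
  also have "\<dots> = (P \<rho> \<theta> (-1) + P \<rho> \<theta> 1) * (Q \<rho> \<theta> (-1) + Q \<rho> \<theta> 1) / 2 ^ k"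
    by (simp add: prob_reply algebra_simps)
  also have "P \<rho> \<theta> (-1) + P \<rho> \<theta> 1 = 1 - P \<rho> \<theta> 0"
    using P_Q_sums(1) by simp
  also have "Q \<rho> \<theta> (-1) + Q \<rho> \<theta> 1 = 1 - Q \<rho> \<theta> 0"
    using P_Q_sums(2) by simp
  finally show ?thesis .
qed

text \<open>The undecided probabilities form a convergent geometric series, so by Borel-Cantelli
  almost every point is eventually decided.\<close>

lemma AE_halts: "AE x in M. halts \<rho> \<theta> x"
proof -
  have "summable (\<lambda>k. (1 - P \<rho> \<theta> 0) * (1 - Q \<rho> \<theta> 0) * (1 / 2) ^ k)"
    by (intro summable_mult summable_geometric) simp
  then have "AE x in M. eventually (\<lambda>k. x \<in> space M - {x. undecided \<rho> \<theta> k x}) sequentially"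
    by (intro borel_cantelli_AE1)
      (auto simp: prob_undecided power_one_over less_top[symmetric])
  then show ?thesis
    by (rule eventually_mono) (auto simp: halts_iff eventually_sequentially)
qed

text \<open>The expectation of a natural-number variable is the sum of its tail probabilities, here
  a geometric series with ratio \<open>1/2\<close>.\<close>

lemma has_integral_later_rounds:
  "has_bochner_integral M (\<lambda>x. real (later_rounds \<rho> \<theta> x)) (2 * (1 - P \<rho> \<theta> 0) * (1 - Q \<rho> \<theta> 0))"
proof (rule has_bochner_integral_nn_integral)
  let ?q = "(1 - P \<rho> \<theta> 0) * (1 - Q \<rho> \<theta> 0)"
  \<comment> \<open>The constant is itself a probability, namely that of being undecided after Round
    1.\<close>
  have q: "0 \<le> ?q"
    using prob_undecided[of 0] measure_nonneg[of M] by (metis div_by_1 power_0)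
  then show "0 \<le> 2 * (1 - P \<rho> \<theta> 0) * (1 - Q \<rho> \<theta> 0)"
    by (simp only: mult.assoc mult_nonneg_nonneg zero_le_numeral)
  have meas: "later_rounds \<rho> \<theta> \<in> M \<rightarrow>\<^sub>M count_space UNIV"
    using measurable_later_rounds by measurable
  then show "(\<lambda>x. real (later_rounds \<rho> \<theta> x)) \<in> borel_measurable M"
    by measurable
  have tail: "emeasure M {x \<in> space M. k < later_rounds \<rho> \<theta> x} = ennreal (?q * (1 / 2) ^ k)" for k
  proof -
    have "AE x in M. x \<in> {x. k < later_rounds \<rho> \<theta> x} \<longleftrightarrow> x \<in> {x. undecided \<rho> \<theta> k x}"
      using AE_M_generic AE_halts by eventually_elim (simp add: undecided_less_iff)
    moreover have "{x. k < later_rounds \<rho> \<theta> x} \<in> sets M"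
      using measurable_sets[OF meas, of "{k<..}"] by (simp add: vimage_def)
    ultimately have "M.prob {x. k < later_rounds \<rho> \<theta> x} = M.prob {x. undecided \<rho> \<theta> k x}"
      by (intro M.finite_measure_eq_AE) auto
    then show ?thesis
      by (simp add: M.emeasure_eq_measure prob_undecided power_one_over)
  qed
  have "(\<lambda>k. ?q * (1 / 2) ^ k) sums (?q * 2)"
    using sums_mult[OF geometric_sums[of "1 / 2 :: real"], of ?q] by simp
  then have "(\<Sum>k. ennreal (?q * (1 / 2) ^ k)) = ennreal (?q * 2)"
    using q by (subst suminf_ennreal2) (auto simp: sums_iff)
  moreover have "(\<integral>\<^sup>+ x. ennreal (real (later_rounds \<rho> \<theta> x)) \<partial>M) = (\<Sum>k. ennreal (?q * (1 / 2) ^ k))"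
    using nn_integral_nat_function[OF meas] by (simp only: ennreal_of_nat_eq_real_of_nat tail)
  moreover have "?q * 2 = 2 * (1 - P \<rho> \<theta> 0) * (1 - Q \<rho> \<theta> 0)"
    by (simp only: mult_ac)
  ultimately show "(\<integral>\<^sup>+ x. ennreal (real (later_rounds \<rho> \<theta> x)) \<partial>M) = ennreal (2 * (1 - P \<rho> \<theta> 0) * (1 - Q \<rho> \<theta> 0))"
    by (simp only:)
qed simp

text \<open>Almost surely the cost is a finite combination of indicators of the seven outcomes. The
  first message contributes the entropy of \<open>Q\<close>; the reply, sent with probability
  \<open>1 - Q \<rho> \<theta> 0\<close>, contributes that of \<open>P\<close>.\<close>

lemma has_integral_first_cost:
  "has_bochner_integral M (\<lambda>x. first_cost \<rho> \<theta> (first_round \<rho> \<theta> x))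
    (entropy_vec (Q \<rho> \<theta>) + (1 - Q \<rho> \<theta> 0) * entropy_vec (P \<rho> \<theta>))"
proof -
  have fin: "finite outcomes"
    by (simp add: outcomes_def)
  let ?g = "\<lambda>x. \<Sum>v\<in>outcomes. first_cost \<rho> \<theta> v * indicator {x. first_round \<rho> \<theta> x = v} x"
  have g: "has_bochner_integral M ?g (\<Sum>v\<in>outcomes. first_cost \<rho> \<theta> v * M.prob {x. first_round \<rho> \<theta> x = v})"
    by (intro has_bochner_integral_sum has_bochner_integral_mult_right has_bochner_integral_real_indicator)
      (auto simp: less_top[symmetric])
  have AE: "AE x in M. ?g x = first_cost \<rho> \<theta> (first_round \<rho> \<theta> x)"
    using AE_M_generic
  proof (rule eventually_mono)
    fix x assume "generic \<rho> \<theta> x \<and> x \<in> babai_cell \<rho> \<theta>"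
    then have "first_round \<rho> \<theta> x \<in> outcomes"
      by (intro first_round_outcomes) auto
    then show "?g x = first_cost \<rho> \<theta> (first_round \<rho> \<theta> x)"
      using fin by (simp add: indicator_def sum.delta' if_distrib cong: if_cong)
  qed
  have meas: "(\<lambda>x. first_cost \<rho> \<theta> (first_round \<rho> \<theta> x)) \<in> borel_measurable M"
    using measurable_compose[OF measurable_first_round[of \<rho> \<theta>], of "first_cost \<rho> \<theta>" borel] by simp
  have "(\<Sum>v\<in>outcomes. first_cost \<rho> \<theta> v * M.prob {x. first_round \<rho> \<theta> x = v})
    = entropy_vec (Q \<rho> \<theta>) + (1 - Q \<rho> \<theta> 0) * entropy_vec (P \<rho> \<theta>)"
  proof -
    have out: "outcomes = insert (0, None) ({-1, 1} \<times> {Some (-1), Some 0, Some 1})"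
      by (auto simp: outcomes_def)
    have log: "log 2 (1 / y) = - log 2 y" if "0 < y" for y :: real
      using that by (simp add: log_divide)
    have pos: "0 < Q \<rho> \<theta> (-1)" "0 < Q \<rho> \<theta> 0" "0 < Q \<rho> \<theta> 1" "0 < P \<rho> \<theta> (-1)" "0 < P \<rho> \<theta> 0" "0 < P \<rho> \<theta> 1"
      using c_bounds h_pos tau1_bounds by (auto simp: Q_values P_values)
    have "(\<Sum>v\<in>outcomes. first_cost \<rho> \<theta> v * M.prob {x. first_round \<rho> \<theta> x = v})
      = first_cost \<rho> \<theta> (0, None) * Q \<rho> \<theta> 0
        + (\<Sum>i\<in>{-1, 1}. \<Sum>u\<in>{Some (-1), Some 0, Some 1}. first_cost \<rho> \<theta> (i, u) * M.prob {x. first_round \<rho> \<theta> x = (i, u)})"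
      unfolding out by (subst sum.insert) (auto simp: prob_central sum.cartesian_product case_prod_unfold)
    \<comment> \<open>The factors are grouped so that the reply probabilities sum to 1 in the cost
      of the first message.\<close>
    also have "\<dots> = - (Q \<rho> \<theta> 0 * log 2 (Q \<rho> \<theta> 0))
        - (Q \<rho> \<theta> (-1) * log 2 (Q \<rho> \<theta> (-1)) + Q \<rho> \<theta> 1 * log 2 (Q \<rho> \<theta> 1)) * (P \<rho> \<theta> (-1) + P \<rho> \<theta> 0 + P \<rho> \<theta> 1)
        - (Q \<rho> \<theta> (-1) + Q \<rho> \<theta> 1) * (P \<rho> \<theta> (-1) * log 2 (P \<rho> \<theta> (-1)) + P \<rho> \<theta> 0 * log 2 (P \<rho> \<theta> 0)
           + P \<rho> \<theta> 1 * log 2 (P \<rho> \<theta> 1))"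
      by (simp add: prob_reply first_cost_def log pos algebra_simps)
    also have "P \<rho> \<theta> (-1) + P \<rho> \<theta> 0 + P \<rho> \<theta> 1 = 1"
      by (rule P_Q_sums)
    also have "Q \<rho> \<theta> (-1) + Q \<rho> \<theta> 1 = 1 - Q \<rho> \<theta> 0"
      using P_Q_sums(2) by simp
    finally show ?thesis
      by (simp add: entropy_vec_def algebra_simps)
  qed
  with g have "has_bochner_integral M ?g (entropy_vec (Q \<rho> \<theta>) + (1 - Q \<rho> \<theta> 0) * entropy_vec (P \<rho> \<theta>))"
    by (simp only:)
  then show ?thesis
    using has_bochner_integral_cong_AE[OF borel_measurable_has_bochner_integral[OF g] meas AE] by (simp only:)
qed

end

theorem theorem1:
  fixes \<rho> \<theta> :: real
  assumes "\<rho> \<ge> 1" and "0 < \<theta>" and "\<theta> < pi / 2"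
    and "0 < \<rho> * cos \<theta>" and "\<rho> * cos \<theta> < 1 / 2"
  shows "(AE x in babai_law \<rho> \<theta>. halts \<rho> \<theta> x)
    \<and> (\<exists>(D1 :: real \<Rightarrow> transcript \<Rightarrow> real \<times> real) (D2 :: real \<Rightarrow> transcript \<Rightarrow> real \<times> real).
         AE x in babai_law \<rho> \<theta>. halts \<rho> \<theta> x \<longrightarrow>
           {p \<in> lat \<rho> \<theta>. x \<in> voronoi_cell \<rho> \<theta> p} = {D1 (fst x) (final_transcript \<rho> \<theta> x)} \<and>
           {p \<in> lat \<rho> \<theta>. x \<in> voronoi_cell \<rho> \<theta> p} = {D2 (snd x) (final_transcript \<rho> \<theta> x)})
    \<and> integrable (babai_law \<rho> \<theta>) (\<lambda>x. R \<rho> \<theta> x)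
    \<and> (\<integral>x. R \<rho> \<theta> x \<partial>babai_law \<rho> \<theta>) =
         entropy_vec (Q \<rho> \<theta>) + (1 - Q \<rho> \<theta> 0) * entropy_vec (P \<rho> \<theta>)
         + 4 * (1 - P \<rho> \<theta> 0) * (1 - Q \<rho> \<theta> 0)
    \<and> integrable (babai_law \<rho> \<theta>) (\<lambda>x. real (N \<rho> \<theta> x))
    \<and> (\<integral>x. real (N \<rho> \<theta> x) \<partial>babai_law \<rho> \<theta>) =
         1 + 2 * (1 - P \<rho> \<theta> 0) * (1 - Q \<rho> \<theta> 0)"
proof -
  interpret babai \<rho> \<theta>
    using assms by unfold_locales
  have decode: "AE x in M. halts \<rho> \<theta> x \<longrightarrow> nearest \<rho> \<theta> x = {decode (final_transcript \<rho> \<theta> x)}"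
    using AE_M_generic by (rule eventually_mono) (simp add: nearest_decode)
  \<comment> \<open>Both decoders ignore the node's own coordinate: the common transcript
    suffices.\<close>
  have "\<exists>(D1 :: real \<Rightarrow> transcript \<Rightarrow> real \<times> real) (D2 :: real \<Rightarrow> transcript \<Rightarrow> real \<times> real).
         AE x in M. halts \<rho> \<theta> x \<longrightarrow>
           {p \<in> lat \<rho> \<theta>. x \<in> voronoi_cell \<rho> \<theta> p} = {D1 (fst x) (final_transcript \<rho> \<theta> x)} \<and>
           {p \<in> lat \<rho> \<theta>. x \<in> voronoi_cell \<rho> \<theta> p} = {D2 (snd x) (final_transcript \<rho> \<theta> x)}"
    using decode by (intro exI[of _ "\<lambda>_. decode"]) (simp add: nearest_def)
  \<comment> \<open>Each later round costs two bits, which doubles the expected number of later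
    rounds and gives the factor 4.\<close>
  moreover have "has_bochner_integral M (R \<rho> \<theta>)
      (entropy_vec (Q \<rho> \<theta>) + (1 - Q \<rho> \<theta> 0) * entropy_vec (P \<rho> \<theta>) + 2 * (2 * (1 - P \<rho> \<theta> 0) * (1 - Q \<rho> \<theta> 0)))"
    unfolding R_eq
    by (intro has_bochner_integral_add has_integral_first_cost has_bochner_integral_mult_right has_integral_later_rounds)
  moreover have "has_bochner_integral M (\<lambda>x. 1 + real (later_rounds \<rho> \<theta> x)) (1 + 2 * (1 - P \<rho> \<theta> 0) * (1 - Q \<rho> \<theta> 0))"
    using has_integral_later_rounds M.prob_space by (simp add: has_bochner_integral_iff)
  then have "has_bochner_integral M (\<lambda>x. real (N \<rho> \<theta> x)) (1 + 2 * (1 - P \<rho> \<theta> 0) * (1 - Q \<rho> \<theta> 0))"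
    by (simp add: N_eq)
  ultimately show ?thesis
    using AE_halts by (simp add: has_bochner_integral_iff)
qed

end
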